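(* Let $n\ge 1$ and let $\mu=(\mu_1,\ldots,\mu_n)\in\mathbb{C}^n$ be generic. The second cohomology space $H^2(\mathbf{WA}(n)_\mu,\mathbb{C})$ of the Lie algebra $\mathbf{WA}(n)_\mu$ with coefficients in the trivial module $\mathbb{C}$ is three-dimensional, and it is generated by (the classes of) the following $2$-cocycles $C_{\mu,1},C_{\mu,2},C_{\mu,3}:\mathbf{WA}(n)_\mu\times\mathbf{WA}(n)_\mu\to\mathbb{C}$, given on basis elements, for $\alpha,\beta\in\mathbb{Z}^n$, by $$C_{\mu,1}(e_{\mu\cdot\alpha},e_{\mu\cdot\beta})=\delta_{\alpha,-\beta}\,\frac{(\mu\cdot\alpha)^3-(\mu\cdot\alpha)}{12}\,c_{\mu,1},\qquad C_{\mu,1}=0\ \text{on all other pairs of basis elements},$$ $$C_{\mu,2}(e_{\mu\cdot\alpha},h_\beta)=\delta_{\alpha,-\beta}\,\big((\mu\cdot\alpha)^2-(\mu\cdot\alpha)\big)\,c_{\mu,2},\qquad C_{\mu,2}=0\ \text{otherwise},$$ $$C_{\mu,3}(h_\alpha,h_\beta)=\delta_{\alpha,-\beta}\,\frac{\mu\cdot\alpha}{3}\,c_{\mu,3},\qquad C_{\mu,3}=0\ \text{on all other pairs of basis elements},$$ where $c_{\mu,1},c_{\mu,2},c_{\mu,3}$ are fixed nonzero constants, and where each $C_{\mu,i}$ is extended bilinearly and skew-symmetrically (so $C_{\mu,2}(h_\beta,e_{\mu\cdot\alpha})=-C_{\mu,2}(e_{\mu\cdot\alpha},h_\beta)$, and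 $C_{\mu,2}$ vanishes on pairs $(e,e)$ and $(h,h)$).
   Context: A vector $\mu\in\mathbb{C}^n$ is generic if $\mu\cdot\alpha:=\sum_{i=1}^n\mu_i\alpha_i\ne 0$ for all $\alpha\in\mathbb{Z}^n\setminus\{\overrightarrow{0}\}$. Let $A_n=\mathbb{C}[t_1^{\pm1},\ldots,t_n^{\pm1}]$, $t^\alpha=t_1^{\alpha_1}\cdots t_n^{\alpha_n}$, $d_\mu=\sum_{i=1}^n\mu_i t_i\frac{\partial}{\partial t_i}$, and let $\mathbf{W}(n)_\mu=A_nd_\mu$ be the solenoidal Lie algebra, a Lie subalgebra of $\mathrm{Der}(A_n)$. The Lie algebra $\mathbf{WA}(n)_\mu=\mathbf{W}(n)_\mu\ltimes A_n$ is the semidirect product in which $A_n$ is an abelian ideal and $\mathbf{W}(n)_\mu$ acts on it by derivations. It has basis $\{e_{\mu\cdot\alpha}=t^\alpha d_\mu,\ h_\alpha=t^\alpha:\alpha\in\mathbb{Z}^n\}$ and brackets $$[e_{\mu\cdot\alpha},e_{\mu\cdot\beta}]=\mu\cdot(\beta-\alpha)\,e_{\mu\cdot(\alpha+\beta)},\quad [h_\alpha,h_\beta]=0,\quad [e_{\mu\cdot\alpha},h_\beta]=(\mu\cdot\beta)\,h_{\alpha+\beta}.$$ A $2$-cocycle is a skew-symmetric bilinear map $C:\mathbf{WA}(n)_\mu\times\mathbf{WA}(n)_\mu\to\mathbb{C}$ with $C([X,Y],Z)+C([Y,Z],X)+C([Z,X],Y)=0$ for all $X,Y,Z$. *)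

theory Defs
  imports
    Complex_Main
    "HOL-Library.Poly_Mapping"
    "HOL-Analysis.Finite_Cartesian_Product"
    "HOL-Algebra.AbelCoset"
    "HOL-Algebra.Module"
    "Jordan_Normal_Form.Missing_VectorSpace"
begin

section \<open>Lie algebras and their second cohomology\<close>

definition complex_field :: "complex ring" where
  "complex_field = \<lparr>carrier = UNIV, mult = (*), one = 1, zero = 0, add = (+)\<rparr>"

text \<open>
  The fields \<open>mult\<close> and \<open>one\<close> inherited by the record type \<open>module\<close> from \<open>ring\<close> play no role
  in the locales \<open>module\<close> and \<open>vectorspace\<close>; they are left \<open>undefined\<close> below.
\<close>

record ('k, 'a) lie_alg = "('k, 'a) module" +
  lie_bracket :: "'a \<Rightarrow> 'a \<Rightarrow> 'a"

locale lie_algebra = module R L for R and L :: "('k, 'a, 'm) lie_alg_scheme" +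
  assumes bracket_closed:
      "\<lbrakk>x \<in> carrier L; y \<in> carrier L\<rbrakk> \<Longrightarrow> lie_bracket L x y \<in> carrier L"
    and bracket_add_left: "\<lbrakk>x \<in> carrier L; y \<in> carrier L; z \<in> carrier L\<rbrakk> \<Longrightarrow>
      lie_bracket L (x \<oplus>\<^bsub>L\<^esub> y) z = lie_bracket L x z \<oplus>\<^bsub>L\<^esub> lie_bracket L y z"
    and bracket_add_right: "\<lbrakk>x \<in> carrier L; y \<in> carrier L; z \<in> carrier L\<rbrakk> \<Longrightarrow>
      lie_bracket L x (y \<oplus>\<^bsub>L\<^esub> z) = lie_bracket L x y \<oplus>\<^bsub>L\<^esub> lie_bracket L x z"
    and bracket_smult_left: "\<lbrakk>a \<in> carrier R; x \<in> carrier L; y \<in> carrier L\<rbrakk> \<Longrightarrow>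
      lie_bracket L (a \<odot>\<^bsub>L\<^esub> x) y = a \<odot>\<^bsub>L\<^esub> lie_bracket L x y"
    and bracket_smult_right: "\<lbrakk>a \<in> carrier R; x \<in> carrier L; y \<in> carrier L\<rbrakk> \<Longrightarrow>
      lie_bracket L x (a \<odot>\<^bsub>L\<^esub> y) = a \<odot>\<^bsub>L\<^esub> lie_bracket L x y"
    and bracket_self: "x \<in> carrier L \<Longrightarrow> lie_bracket L x x = \<zero>\<^bsub>L\<^esub>"
    and jacobi: "\<lbrakk>x \<in> carrier L; y \<in> carrier L; z \<in> carrier L\<rbrakk> \<Longrightarrow>
      lie_bracket L (lie_bracket L x y) z \<oplus>\<^bsub>L\<^esub> (lie_bracket L (lie_bracket L y z) x
        \<oplus>\<^bsub>L\<^esub> lie_bracket L (lie_bracket L z x) y) = \<zero>\<^bsub>L\<^esub>"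

text \<open>
  A form on the carrier of \<open>L\<close> is represented by a function on the whole type that vanishes
  as soon as one of the arguments is outside the carrier, so that equality of functions is
  equality of forms.
\<close>

definition skew_bilinear_forms ::
    "(complex, 'a, 'm) lie_alg_scheme \<Rightarrow> ('a \<Rightarrow> 'a \<Rightarrow> complex) set" where
  "skew_bilinear_forms L = {C.
     (\<forall>x y. x \<notin> carrier L \<or> y \<notin> carrier L \<longrightarrow> C x y = 0) \<and>
     (\<forall>x\<in>carrier L. \<forall>y\<in>carrier L. \<forall>z\<in>carrier L. C (x \<oplus>\<^bsub>L\<^esub> y) z = C x z + C y z) \<and>
     (\<forall>x\<in>carrier L. \<forall>y\<in>carrier L. \<forall>z\<in>carrier L. C x (y \<oplus>\<^bsub>L\<^esub> z) = C x y + C x z) \<and>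
     (\<forall>a. \<forall>x\<in>carrier L. \<forall>y\<in>carrier L. C (a \<odot>\<^bsub>L\<^esub> x) y = a * C x y) \<and>
     (\<forall>a. \<forall>x\<in>carrier L. \<forall>y\<in>carrier L. C x (a \<odot>\<^bsub>L\<^esub> y) = a * C x y) \<and>
     (\<forall>x\<in>carrier L. \<forall>y\<in>carrier L. C x y = - C y x)}"

definition two_cocycles ::
    "(complex, 'a, 'm) lie_alg_scheme \<Rightarrow> ('a \<Rightarrow> 'a \<Rightarrow> complex) set" where
  "two_cocycles L = {C \<in> skew_bilinear_forms L.
     \<forall>x\<in>carrier L. \<forall>y\<in>carrier L. \<forall>z\<in>carrier L.
       C (lie_bracket L x y) z + C (lie_bracket L y z) x + C (lie_bracket L z x) y = 0}"

definition linear_functionals ::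
    "(complex, 'a, 'm) lie_alg_scheme \<Rightarrow> ('a \<Rightarrow> complex) set" where
  "linear_functionals L = {f.
     (\<forall>x\<in>carrier L. \<forall>y\<in>carrier L. f (x \<oplus>\<^bsub>L\<^esub> y) = f x + f y) \<and>
     (\<forall>a. \<forall>x\<in>carrier L. f (a \<odot>\<^bsub>L\<^esub> x) = a * f x)}"

definition two_coboundaries ::
    "(complex, 'a, 'm) lie_alg_scheme \<Rightarrow> ('a \<Rightarrow> 'a \<Rightarrow> complex) set" where
  "two_coboundaries L =
     {(\<lambda>x y. if x \<in> carrier L \<and> y \<in> carrier L then f (lie_bracket L x y) else 0) | f.
        f \<in> linear_functionals L}"

definition cocycle_space ::
    "(complex, 'a, 'm) lie_alg_scheme \<Rightarrow> (complex, 'a \<Rightarrow> 'a \<Rightarrow> complex) module" where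
  "cocycle_space L =
     \<lparr>carrier = two_cocycles L, mult = undefined, one = undefined,
      zero = (\<lambda>x y. 0), add = (\<lambda>C D x y. C x y + D x y), smult = (\<lambda>a C x y. a * C x y)\<rparr>"

definition quotient_module ::
    "('k, 'a, 'm) module_scheme \<Rightarrow> 'a set \<Rightarrow> ('k, 'a set) module" where
  "quotient_module M N =
     \<lparr>carrier = a_rcosets\<^bsub>M\<^esub> N, mult = undefined, one = undefined,
      zero = N, add = set_add M, smult = (\<lambda>a X. \<Union>x\<in>X. N +>\<^bsub>M\<^esub> (a \<odot>\<^bsub>M\<^esub> x))\<rparr>"

definition second_cohomology ::
    "(complex, 'a, 'm) lie_alg_scheme \<Rightarrow> (complex, ('a \<Rightarrow> 'a \<Rightarrow> complex) set) module" where
  "second_cohomology L = quotient_module (cocycle_space L) (two_coboundaries L)"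

definition cohomology_class ::
    "(complex, 'a, 'm) lie_alg_scheme \<Rightarrow> ('a \<Rightarrow> 'a \<Rightarrow> complex) \<Rightarrow> ('a \<Rightarrow> 'a \<Rightarrow> complex) set" where
  "cohomology_class L C = two_coboundaries L +>\<^bsub>cocycle_space L\<^esub> C"


section \<open>Laurent polynomials and the solenoidal Lie algebra\<close>

definition pairing :: "complex ^ 'n \<Rightarrow> int ^ 'n \<Rightarrow> complex" where
  "pairing \<mu> \<alpha> = (\<Sum>i\<in>UNIV. \<mu> $ i * of_int (\<alpha> $ i))"

definition generic :: "complex ^ 'n \<Rightarrow> bool" where
  "generic \<mu> \<longleftrightarrow> (\<forall>\<alpha>. \<alpha> \<noteq> 0 \<longrightarrow> pairing \<mu> \<alpha> \<noteq> 0)"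

text \<open>
  Laurent polynomials in variables indexed by \<open>'n\<close>: finitely supported functions on the
  exponents \<open>int ^ 'n\<close>, with the convolution product of \<open>HOL-Library.Poly_Mapping\<close>.
\<close>

type_synonym 'n laurent = "(int ^ 'n) \<Rightarrow>\<^sub>0 complex"

abbreviation laurent_monom :: "int ^ 'n \<Rightarrow> 'n laurent" where
  "laurent_monom \<alpha> \<equiv> Poly_Mapping.single \<alpha> 1"

abbreviation laurent_scale :: "complex \<Rightarrow> 'n laurent \<Rightarrow> 'n::finite laurent" where
  "laurent_scale c f \<equiv> Poly_Mapping.single 0 c * f"

definition laurent_partial :: "'n \<Rightarrow> 'n laurent \<Rightarrow> 'n::finite laurent" where
  "laurent_partial i f =
     (\<Sum>\<alpha>\<in>Poly_Mapping.keys f.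
        Poly_Mapping.single (\<alpha> - axis i 1) (of_int (\<alpha> $ i) * Poly_Mapping.lookup f \<alpha>))"

definition dmu :: "complex ^ 'n \<Rightarrow> 'n laurent \<Rightarrow> 'n::finite laurent" where
  "dmu \<mu> f = (\<Sum>i\<in>UNIV. laurent_scale (\<mu> $ i) (laurent_monom (axis i 1) * laurent_partial i f))"

definition solenoidal :: "complex ^ 'n \<Rightarrow> ('n laurent \<Rightarrow> 'n::finite laurent) set" where
  "solenoidal \<mu> = {(\<lambda>u. f * dmu \<mu> u) | f. True}"

text \<open>
  The pair \<open>(D, f)\<close> is the element \<open>D + f\<close> of the semidirect product; the bracket on the
  first component is the commutator of derivations.
\<close>

definition WA :: "complex ^ 'n \<Rightarrow>
    (complex, ('n laurent \<Rightarrow> 'n laurent) \<times> 'n::finite laurent) lie_alg" where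
  "WA \<mu> =
     \<lparr>carrier = solenoidal \<mu> \<times> UNIV, mult = undefined, one = undefined,
      zero = (\<lambda>u. 0, 0),
      add = (\<lambda>(D, f) (E, g). (\<lambda>u. D u + E u, f + g)),
      smult = (\<lambda>c (D, f). (\<lambda>u. laurent_scale c (D u), laurent_scale c f)),
      lie_bracket = (\<lambda>(D, f) (E, g). (\<lambda>u. D (E u) - E (D u), D g - E f))\<rparr>"

definition e_gen :: "complex ^ 'n \<Rightarrow> int ^ 'n \<Rightarrow>
    ('n laurent \<Rightarrow> 'n laurent) \<times> 'n::finite laurent" where
  "e_gen \<mu> \<alpha> = (\<lambda>u. laurent_monom \<alpha> * dmu \<mu> u, 0)"

definition h_gen :: "int ^ 'n \<Rightarrow> ('n laurent \<Rightarrow> 'n laurent) \<times> 'n::finite laurent" where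
  "h_gen \<alpha> = (\<lambda>u. 0, laurent_monom \<alpha>)"


section \<open>The three cocycles\<close>

text \<open>Well defined for generic \<open>\<mu>\<close>; see \<open>dmu_coeff_eq\<close> below.\<close>

definition dmu_coeff :: "complex ^ 'n \<Rightarrow> ('n laurent \<Rightarrow> 'n laurent) \<Rightarrow> 'n::finite laurent" where
  "dmu_coeff \<mu> D = (THE f. D = (\<lambda>u. f * dmu \<mu> u))"

definition pair_sum :: "(int ^ 'n \<Rightarrow> int ^ 'n \<Rightarrow> complex) \<Rightarrow> 'n laurent \<Rightarrow> 'n laurent \<Rightarrow> complex" where
  "pair_sum b f g =
     (\<Sum>\<alpha>\<in>Poly_Mapping.keys f. \<Sum>\<beta>\<in>Poly_Mapping.keys g.
        Poly_Mapping.lookup f \<alpha> * Poly_Mapping.lookup g \<beta> * b \<alpha> \<beta>)"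

text \<open>
  The bilinear form with values \<open>ee \<alpha> \<beta>\<close>, \<open>eh \<alpha> \<beta>\<close>, \<open>- eh \<beta> \<alpha>\<close> and \<open>hh \<alpha> \<beta>\<close> on the pairs
  \<open>(e_gen \<mu> \<alpha>, e_gen \<mu> \<beta>)\<close>, \<open>(e_gen \<mu> \<alpha>, h_gen \<beta>)\<close>, \<open>(h_gen \<alpha>, e_gen \<mu> \<beta>)\<close> and \<open>(h_gen \<alpha>, h_gen \<beta>)\<close>.
\<close>

definition form_of_values :: "complex ^ 'n \<Rightarrow> (int ^ 'n \<Rightarrow> int ^ 'n \<Rightarrow> complex) \<Rightarrow>
    (int ^ 'n \<Rightarrow> int ^ 'n \<Rightarrow> complex) \<Rightarrow> (int ^ 'n \<Rightarrow> int ^ 'n \<Rightarrow> complex) \<Rightarrow>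
    ('n laurent \<Rightarrow> 'n laurent) \<times> 'n::finite laurent \<Rightarrow>
    ('n laurent \<Rightarrow> 'n laurent) \<times> 'n laurent \<Rightarrow> complex" where
  "form_of_values \<mu> ee eh hh X Y =
     (if X \<in> carrier (WA \<mu>) \<and> Y \<in> carrier (WA \<mu>)
      then pair_sum ee (dmu_coeff \<mu> (fst X)) (dmu_coeff \<mu> (fst Y))
         + pair_sum eh (dmu_coeff \<mu> (fst X)) (snd Y)
         - pair_sum eh (dmu_coeff \<mu> (fst Y)) (snd X)
         + pair_sum hh (snd X) (snd Y)
      else 0)"

definition cocycle1 where
  "cocycle1 \<mu> c = form_of_values \<mu>
     (\<lambda>\<alpha> \<beta>. if \<alpha> = - \<beta> then ((pairing \<mu> \<alpha>) ^ 3 - pairing \<mu> \<alpha>) / 12 * c else 0)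
     (\<lambda>\<alpha> \<beta>. 0) (\<lambda>\<alpha> \<beta>. 0)"

definition cocycle2 where
  "cocycle2 \<mu> c = form_of_values \<mu> (\<lambda>\<alpha> \<beta>. 0)
     (\<lambda>\<alpha> \<beta>. if \<alpha> = - \<beta> then ((pairing \<mu> \<alpha>) ^ 2 - pairing \<mu> \<alpha>) * c else 0)
     (\<lambda>\<alpha> \<beta>. 0)"

definition cocycle3 where
  "cocycle3 \<mu> c = form_of_values \<mu> (\<lambda>\<alpha> \<beta>. 0) (\<lambda>\<alpha> \<beta>. 0)
     (\<lambda>\<alpha> \<beta>. if \<alpha> = - \<beta> then pairing \<mu> \<alpha> / 3 * c else 0)"


section \<open>Basic facts\<close>

lemma pairing_zero: "pairing \<mu> 0 = 0"
  by (simp add: pairing_def)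

lemma pairing_diff: "pairing \<mu> (\<alpha> - \<beta>) = pairing \<mu> \<alpha> - pairing \<mu> \<beta>"
  by (simp add: pairing_def sum_subtractf algebra_simps)

lemma pairing_add: "pairing \<mu> (\<alpha> + \<beta>) = pairing \<mu> \<alpha> + pairing \<mu> \<beta>"
  by (simp add: pairing_def sum.distrib algebra_simps)

lemma monom_times_laurent_partial:
  "laurent_monom (axis i 1) * laurent_partial i f =
    (\<Sum>\<alpha>\<in>Poly_Mapping.keys f. Poly_Mapping.single \<alpha> (of_int (\<alpha> $ i) * Poly_Mapping.lookup f \<alpha>))"
  by (simp add: laurent_partial_def sum_distrib_left mult_single)

lemma lookup_sum_single:
  "Poly_Mapping.lookup (\<Sum>\<alpha>\<in>Poly_Mapping.keys f. Poly_Mapping.single \<alpha> (c \<alpha> * Poly_Mapping.lookup f \<alpha>)) \<beta>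
    = c \<beta> * Poly_Mapping.lookup (f :: _ \<Rightarrow>\<^sub>0 complex) \<beta>"
proof -
  have "(\<Sum>\<alpha>\<in>Poly_Mapping.keys f. (c \<alpha> * Poly_Mapping.lookup f \<alpha>) when \<alpha> = \<beta>)
      = c \<beta> * Poly_Mapping.lookup f \<beta>"
    by (cases "\<beta> \<in> Poly_Mapping.keys f") (auto simp: when_def in_keys_iff)
  then show ?thesis by (simp add: lookup_sum lookup_single)
qed

lemma laurent_eq_sum_single:
  "(\<Sum>\<alpha>\<in>Poly_Mapping.keys f. Poly_Mapping.single \<alpha> (Poly_Mapping.lookup f \<alpha>)) = f"
  for f :: "_ \<Rightarrow>\<^sub>0 complex"
  using lookup_sum_single[of "\<lambda>_. 1" f] by (intro poly_mapping_eqI) simp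

lemma lookup_scale:
  "Poly_Mapping.lookup (Poly_Mapping.single 0 c * f) \<beta> = c * Poly_Mapping.lookup f \<beta>"
  for f :: "'n::finite laurent"
proof -
  have "Poly_Mapping.single 0 c * f = Poly_Mapping.single 0 c *
      (\<Sum>\<alpha>\<in>Poly_Mapping.keys f. Poly_Mapping.single \<alpha> (Poly_Mapping.lookup f \<alpha>))"
    by (simp add: laurent_eq_sum_single)
  also have "\<dots> = (\<Sum>\<alpha>\<in>Poly_Mapping.keys f. Poly_Mapping.single \<alpha> (c * Poly_Mapping.lookup f \<alpha>))"
    by (simp add: sum_distrib_left mult_single)
  finally show ?thesis by (simp add: lookup_sum_single)
qed

lemma lookup_dmu: "Poly_Mapping.lookup (dmu \<mu> f) \<beta> = pairing \<mu> \<beta> * Poly_Mapping.lookup f \<beta>"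
proof -
  have "Poly_Mapping.lookup (laurent_monom (axis i 1) * laurent_partial i f) \<beta>
      = of_int (\<beta> $ i) * Poly_Mapping.lookup f \<beta>" for i
    unfolding monom_times_laurent_partial by (rule lookup_sum_single)
  then show ?thesis
    by (simp add: dmu_def lookup_sum lookup_scale pairing_def sum_distrib_right mult.assoc)
qed

lemma dmu_single:
  "dmu \<mu> (Poly_Mapping.single \<alpha> c) = Poly_Mapping.single \<alpha> (pairing \<mu> \<alpha> * c)"
  by (rule poly_mapping_eqI) (simp add: lookup_dmu lookup_single when_def)

lemma dmu_add: "dmu \<mu> (f + g) = dmu \<mu> f + dmu \<mu> g"
  by (rule poly_mapping_eqI) (simp add: lookup_dmu lookup_add algebra_simps)

lemma dmu_diff: "dmu \<mu> (f - g) = dmu \<mu> f - dmu \<mu> g"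
  by (rule poly_mapping_eqI) (simp add: lookup_dmu lookup_minus algebra_simps)

lemma dmu_zero [simp]: "dmu \<mu> 0 = 0"
  by (rule poly_mapping_eqI) (simp add: lookup_dmu)

lemma dmu_sum: "dmu \<mu> (\<Sum>x\<in>A. f x) = (\<Sum>x\<in>A. dmu \<mu> (f x))"
  by (induction A rule: infinite_finite_induct) (simp_all add: dmu_add)

lemma dmu_mult: "dmu \<mu> (f * g) = dmu \<mu> f * g + f * dmu \<mu> g" for f g :: "'n::finite laurent"
proof -
  let ?m = "\<lambda>f \<alpha>. Poly_Mapping.single \<alpha> (Poly_Mapping.lookup f \<alpha>) :: 'n laurent"
  have f: "f = (\<Sum>\<alpha>\<in>Poly_Mapping.keys f. ?m f \<alpha>)" and g: "g = (\<Sum>\<alpha>\<in>Poly_Mapping.keys g. ?m g \<alpha>)"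
    by (simp_all add: laurent_eq_sum_single)
  have *: "dmu \<mu> (?m f \<alpha> * ?m g \<beta>) = dmu \<mu> (?m f \<alpha>) * ?m g \<beta> + ?m f \<alpha> * dmu \<mu> (?m g \<beta>)" for \<alpha> \<beta>
    by (simp add: mult_single dmu_single pairing_add single_add[symmetric] algebra_simps)
  have "dmu \<mu> ((\<Sum>\<alpha>\<in>Poly_Mapping.keys f. ?m f \<alpha>) * (\<Sum>\<alpha>\<in>Poly_Mapping.keys g. ?m g \<alpha>)) =
      dmu \<mu> (\<Sum>\<alpha>\<in>Poly_Mapping.keys f. ?m f \<alpha>) * (\<Sum>\<alpha>\<in>Poly_Mapping.keys g. ?m g \<alpha>) +
      (\<Sum>\<alpha>\<in>Poly_Mapping.keys f. ?m f \<alpha>) * dmu \<mu> (\<Sum>\<alpha>\<in>Poly_Mapping.keys g. ?m g \<alpha>)"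
    by (simp add: sum_product dmu_sum * sum.distrib)
  with f g show ?thesis by metis
qed

lemma solenoidal_commutator:
  "(\<lambda>u. f * dmu \<mu> (g * dmu \<mu> u) - g * dmu \<mu> (f * dmu \<mu> u)) = (\<lambda>u. (f * dmu \<mu> g - g * dmu \<mu> f) * dmu \<mu> u)"
  by (simp add: dmu_mult algebra_simps fun_eq_iff)

lemma dmu_coeff_eq:
  fixes \<mu> :: "complex ^ 'n::finite"
  assumes "generic \<mu>"
  shows "dmu_coeff \<mu> (\<lambda>u. f * dmu \<mu> u) = f"
  unfolding dmu_coeff_def
proof (rule the_equality)
  fix g assume "(\<lambda>u. f * dmu \<mu> u) = (\<lambda>u. g * dmu \<mu> u)"
  define \<alpha> :: "int ^ 'n" where "\<alpha> = axis undefined 1"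
  have "\<alpha> \<noteq> 0" by (simp add: \<alpha>_def axis_eq_0_iff)
  then have p: "pairing \<mu> \<alpha> \<noteq> 0" using assms by (simp add: generic_def)
  define v where "v = Poly_Mapping.single (- \<alpha>) (1 / pairing \<mu> \<alpha>)"
  have one: "dmu \<mu> (laurent_monom \<alpha>) * v = 1"
    using p by (simp add: v_def dmu_single mult_single)
  have "f * dmu \<mu> (laurent_monom \<alpha>) * v = g * dmu \<mu> (laurent_monom \<alpha>) * v"
    using \<open>(\<lambda>u. f * dmu \<mu> u) = (\<lambda>u. g * dmu \<mu> u)\<close> by metis
  then show "g = f" by (simp add: mult.assoc one)
qed simp

lemma dmu_coeff_zero: "generic \<mu> \<Longrightarrow> dmu_coeff \<mu> (\<lambda>u. 0) = 0"
  using dmu_coeff_eq[of \<mu> 0] by simp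

lemma field_complex_field: "field complex_field"
proof (unfold_locales, auto simp: complex_field_def algebra_simps Units_def)
  fix x :: complex
  show "\<exists>y. x + y = 0" by (rule exI[of _ "- x"]) simp
  show "x \<noteq> 0 \<Longrightarrow> \<exists>y. x * y = 1" by (rule exI[of _ "1 / x"]) simp
qed

lemma WA_carrier_cases:
  assumes "X \<in> carrier (WA \<mu>)"
  obtains f g where "X = (\<lambda>u. f * dmu \<mu> u, g)"
  using assms by (auto simp: WA_def solenoidal_def)

lemma WA_carrierI: "(\<lambda>u. f * dmu \<mu> u, g) \<in> carrier (WA \<mu>)"
  by (auto simp: WA_def solenoidal_def)

lemma WA_ops:
  "\<zero>\<^bsub>WA \<mu>\<^esub> = (\<lambda>u. 0 * dmu \<mu> u, 0)"
  "(\<lambda>u. f * dmu \<mu> u, g) \<oplus>\<^bsub>WA \<mu>\<^esub> (\<lambda>u. f' * dmu \<mu> u, g') = (\<lambda>u. (f + f') * dmu \<mu> u, g + g')"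
  "c \<odot>\<^bsub>WA \<mu>\<^esub> (\<lambda>u. f * dmu \<mu> u, g) = (\<lambda>u. laurent_scale c f * dmu \<mu> u, laurent_scale c g)"
  "lie_bracket (WA \<mu>) (\<lambda>u. f * dmu \<mu> u, g) (\<lambda>u. f' * dmu \<mu> u, g') =
     (\<lambda>u. (f * dmu \<mu> f' - f' * dmu \<mu> f) * dmu \<mu> u, f * dmu \<mu> g' - f' * dmu \<mu> g)"
  by (simp_all add: WA_def solenoidal_commutator algebra_simps)

lemma lie_algebra_WA: "lie_algebra complex_field (WA \<mu>)"
proof -
  have "abelian_group (WA \<mu>)"
  proof (rule abelian_groupI)
    fix x y z
    assume "x \<in> carrier (WA \<mu>)" "y \<in> carrier (WA \<mu>)" "z \<in> carrier (WA \<mu>)"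
    then show "x \<oplus>\<^bsub>WA \<mu>\<^esub> y \<oplus>\<^bsub>WA \<mu>\<^esub> z = x \<oplus>\<^bsub>WA \<mu>\<^esub> (y \<oplus>\<^bsub>WA \<mu>\<^esub> z)"
      by (auto elim!: WA_carrier_cases simp: WA_ops add.assoc)
  next
    fix x y
    assume "x \<in> carrier (WA \<mu>)" "y \<in> carrier (WA \<mu>)"
    then show "x \<oplus>\<^bsub>WA \<mu>\<^esub> y \<in> carrier (WA \<mu>)"
      and "x \<oplus>\<^bsub>WA \<mu>\<^esub> y = y \<oplus>\<^bsub>WA \<mu>\<^esub> x"
      by (auto elim!: WA_carrier_cases simp: WA_ops WA_carrierI add.commute)
  next
    show "\<zero>\<^bsub>WA \<mu>\<^esub> \<in> carrier (WA \<mu>)"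
      unfolding WA_ops by (rule WA_carrierI)
  next
    fix x assume "x \<in> carrier (WA \<mu>)"
    then obtain f g where x: "x = (\<lambda>u. f * dmu \<mu> u, g)" by (rule WA_carrier_cases)
    show "\<zero>\<^bsub>WA \<mu>\<^esub> \<oplus>\<^bsub>WA \<mu>\<^esub> x = x"
      unfolding x WA_ops by simp
    have "(\<lambda>u. - f * dmu \<mu> u, - g) \<oplus>\<^bsub>WA \<mu>\<^esub> x = \<zero>\<^bsub>WA \<mu>\<^esub>"
      unfolding x WA_ops by simp
    then show "\<exists>y\<in>carrier (WA \<mu>). y \<oplus>\<^bsub>WA \<mu>\<^esub> x = \<zero>\<^bsub>WA \<mu>\<^esub>"
      using WA_carrierI by blast
  qed
  moreover have "cring complex_field"
    using field_complex_field by (simp add: field_def domain_def)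
  ultimately have "module complex_field (WA \<mu>)"
    apply (intro moduleI)
          apply (simp_all add: complex_field_def)
        apply (auto elim!: WA_carrier_cases simp: WA_ops WA_carrierI)
      apply (simp_all add: single_add distrib_left distrib_right mult.assoc[symmetric] mult_single)
    done
  then show ?thesis
    apply (intro lie_algebra.intro lie_algebra_axioms.intro)
           apply (auto elim!: WA_carrier_cases simp: WA_ops WA_carrierI)
         apply (simp_all add: dmu_add dmu_diff dmu_mult dmu_single pairing_zero algebra_simps)
    done
qed

lemma e_gen_in_carrier: "e_gen \<mu> \<alpha> \<in> carrier (WA \<mu>)"
  unfolding e_gen_def by (rule WA_carrierI)

lemma h_gen_eq: "h_gen \<alpha> = (\<lambda>u. 0 * dmu \<mu> u, laurent_monom \<alpha>)"
  by (simp add: h_gen_def)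

lemma h_gen_in_carrier: "h_gen \<alpha> \<in> carrier (WA \<mu>)"
  unfolding h_gen_eq[of \<alpha> \<mu>] by (rule WA_carrierI)

lemma bracket_e_e:
  "lie_bracket (WA \<mu>) (e_gen \<mu> \<alpha>) (e_gen \<mu> \<beta>) = pairing \<mu> (\<beta> - \<alpha>) \<odot>\<^bsub>WA \<mu>\<^esub> e_gen \<mu> (\<alpha> + \<beta>)"
  by (simp add: e_gen_def WA_ops dmu_single mult_single pairing_diff add.commute single_diff[symmetric])

lemma bracket_h_h: "lie_bracket (WA \<mu>) (h_gen \<alpha>) (h_gen \<beta>) = \<zero>\<^bsub>WA \<mu>\<^esub>"
  by (simp add: WA_def h_gen_def)

lemma bracket_e_h:
  "lie_bracket (WA \<mu>) (e_gen \<mu> \<alpha>) (h_gen \<beta>) = pairing \<mu> \<beta> \<odot>\<^bsub>WA \<mu>\<^esub> h_gen (\<alpha> + \<beta>)"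
  unfolding e_gen_def h_gen_eq[of _ \<mu>] WA_ops by (simp add: dmu_single mult_single)

lemma pair_sum_monom: "pair_sum b (laurent_monom \<alpha>) (laurent_monom \<beta>) = b \<alpha> \<beta>"
  by (simp add: pair_sum_def)

lemma pair_sum_zero: "pair_sum b 0 g = 0" "pair_sum b f 0 = 0"
  by (simp_all add: pair_sum_def)

lemma form_of_values_basis:
  assumes "generic \<mu>"
  shows "form_of_values \<mu> ee eh hh (e_gen \<mu> \<alpha>) (e_gen \<mu> \<beta>) = ee \<alpha> \<beta>"
    and "form_of_values \<mu> ee eh hh (e_gen \<mu> \<alpha>) (h_gen \<beta>) = eh \<alpha> \<beta>"
    and "form_of_values \<mu> ee eh hh (h_gen \<beta>) (e_gen \<mu> \<alpha>) = - eh \<alpha> \<beta>"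
    and "form_of_values \<mu> ee eh hh (h_gen \<alpha>) (h_gen \<beta>) = hh \<alpha> \<beta>"
  using assms e_gen_in_carrier[of \<mu>] h_gen_in_carrier[of _ \<mu>]
  by (simp_all add: form_of_values_def e_gen_def h_gen_def dmu_coeff_eq dmu_coeff_zero pair_sum_monom
      pair_sum_zero)

end

theory Submission
  imports Defs
begin

text \<open>
  The element \<open>e_gen \<mu> 0\<close> acts diagonally on the basis with eigenvalue \<open>pairing \<mu> \<alpha>\<close> in degree
  \<open>\<alpha>\<close>, and by genericity this eigenvalue vanishes only in degree \<open>0\<close>. Subtracting a coboundary
  therefore makes a cocycle vanish on all pairs of total degree different from \<open>0\<close>. What remains
  are three functions of one degree, the values on the pairs \<open>(e, e)\<close>, \<open>(e, h)\<close>, \<open>(h, h)\<close> in opposite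
  degrees, and each satisfies a functional equation. The solutions are the combinations of the
  cubic and linear, quadratic and linear, and linear functions of \<open>pairing \<mu> \<alpha>\<close>, respectively;
  the linear parts of the first two come from the values of the functional on \<open>e_gen \<mu> 0\<close> and
  \<open>h_gen 0\<close>. The functional equations are solved with just the degrees \<open>\<alpha>\<close>, \<open>\<alpha> + \<beta>0\<close> and
  \<open>\<alpha> + 2 \<beta>0\<close> for a fixed nonzero \<open>\<beta>0\<close>, so no induction over the degree lattice is needed.
\<close>

section \<open>Quotient modules\<close>

context module
begin

lemma submodule_abelian_subgroup:
  assumes "submodule R N M"
  shows "abelian_subgroup N M"
proof -
  interpret N: submodule R N M by fact
  have "subgroup N (add_monoid M)"
  proof (rule add.subgroupI)
    show "N \<noteq> {}" using N.zero_closed by blast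
  next
    fix x assume x: "x \<in> N"
    \<comment> \<open>A submodule is closed under scalar multiplication, and negation is
      multiplication by -1.\<close>
    then have "\<ominus>\<^bsub>M\<^esub> x = (\<ominus> \<one>) \<odot>\<^bsub>M\<^esub> x"
      using N.subset smult_l_minus[of \<one> x] by auto
    then show "\<ominus>\<^bsub>M\<^esub> x \<in> N"
      using x by simp
  qed (use N.subset in auto)
  then show ?thesis
    by (intro abelian_subgroupI3 additive_subgroupI M.abelian_group_axioms)
qed

text \<open>The scalar multiplication of the quotient is a union of cosets over all representatives.
  These cosets coincide, because adding an element of \<open>N\<close> to \<open>x\<close> changes
  the multiple by an element of \<open>N\<close>.\<close>

lemma smult_quotient_module:
  assumes "submodule R N M" and a: "a \<in> carrier R" and x: "x \<in> carrier M"
  shows "a \<odot>\<^bsub>quotient_module M N\<^esub> (N +>\<^bsub>M\<^esub> x) = N +>\<^bsub>M\<^esub> (a \<odot>\<^bsub>M\<^esub> x)"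
proof -
  interpret N: submodule R N M by fact
  interpret S: abelian_subgroup N M by (rule submodule_abelian_subgroup) fact
  have "N +>\<^bsub>M\<^esub> (a \<odot>\<^bsub>M\<^esub> y) = N +>\<^bsub>M\<^esub> (a \<odot>\<^bsub>M\<^esub> x)" if y: "y \<in> N +>\<^bsub>M\<^esub> x" for y
  proof -
    obtain h where h: "h \<in> N" "y = h \<oplus>\<^bsub>M\<^esub> x"
      using y by (auto simp: a_r_coset_def')
    then have "a \<odot>\<^bsub>M\<^esub> y = a \<odot>\<^bsub>M\<^esub> h \<oplus>\<^bsub>M\<^esub> a \<odot>\<^bsub>M\<^esub> x"
      using a x N.subset smult_r_distr by auto
    moreover have "a \<odot>\<^bsub>M\<^esub> h \<in> N" using a h by simp
    ultimately have "a \<odot>\<^bsub>M\<^esub> y \<in> N +>\<^bsub>M\<^esub> (a \<odot>\<^bsub>M\<^esub> x)"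
      by (auto simp: a_r_coset_def')
    then show ?thesis
      using a_repr_independence[OF _ _ S.a_subgroup] a x by simp
  qed
  \<comment> \<open>The index set is nonempty, so the union of equal cosets is that coset and not
    the empty set.\<close>
  moreover have "x \<in> N +>\<^bsub>M\<^esub> x" using x by (rule S.a_rcos_self)
  ultimately have "(\<Union>y\<in>N +>\<^bsub>M\<^esub> x. N +>\<^bsub>M\<^esub> (a \<odot>\<^bsub>M\<^esub> y)) = N +>\<^bsub>M\<^esub> (a \<odot>\<^bsub>M\<^esub> x)"
    by blast
  then show ?thesis by (simp add: quotient_module_def)
qed

lemma quotient_module_carrier:
  "carrier (quotient_module M N) = (\<lambda>x. N +>\<^bsub>M\<^esub> x) ` carrier M"
  by (auto simp: quotient_module_def A_RCOSETS_def')

lemma add_quotient_module: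
  assumes "submodule R N M" and "x \<in> carrier M" and "y \<in> carrier M"
  shows "(N +>\<^bsub>M\<^esub> x) \<oplus>\<^bsub>quotient_module M N\<^esub> (N +>\<^bsub>M\<^esub> y) = N +>\<^bsub>M\<^esub> (x \<oplus>\<^bsub>M\<^esub> y)"
proof -
  interpret S: abelian_subgroup N M by (rule submodule_abelian_subgroup) fact
  show ?thesis using assms by (simp add: quotient_module_def S.a_rcos_sum)
qed

lemma coset_eq_zero_iff:
  assumes "submodule R N M" and "x \<in> carrier M"
  shows "N +>\<^bsub>M\<^esub> x = \<zero>\<^bsub>quotient_module M N\<^esub> \<longleftrightarrow> x \<in> N"
proof -
  interpret S: abelian_subgroup N M by (rule submodule_abelian_subgroup) fact
  show ?thesis
    using assms a_coset_join1[OF _ _ S.a_subgroup] a_coset_join2[OF _ S.a_subgroup]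
    by (auto simp: quotient_module_def)
qed

lemma module_quotient_module:
  assumes N: "submodule R N M"
  shows "module R (quotient_module M N)"
proof -
  let ?Q = "quotient_module M N"
  \<comment> \<open>With zero written as a coset, each axiom becomes an identity between
    representatives and is inherited from \<open>M\<close>.\<close>
  have zero: "\<zero>\<^bsub>?Q\<^esub> = N +>\<^bsub>M\<^esub> \<zero>\<^bsub>M\<^esub>"
    using coset_eq_zero_iff[OF N, of "\<zero>\<^bsub>M\<^esub>"] submodule.zero_closed[OF N] by simp
  have "abelian_group ?Q"
  proof (rule abelian_groupI)
    fix X assume "X \<in> carrier ?Q"
    then obtain x where x: "x \<in> carrier M" "X = N +>\<^bsub>M\<^esub> x"
      by (auto simp: quotient_module_carrier)
    then have "(N +>\<^bsub>M\<^esub> (\<ominus>\<^bsub>M\<^esub> x)) \<oplus>\<^bsub>?Q\<^esub> X = \<zero>\<^bsub>?Q\<^esub>"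
      by (simp add: add_quotient_module[OF N] zero M.l_neg)
    then show "\<exists>Y\<in>carrier ?Q. Y \<oplus>\<^bsub>?Q\<^esub> X = \<zero>\<^bsub>?Q\<^esub>"
      using x by (auto simp: quotient_module_carrier)
  qed (auto simp: quotient_module_carrier add_quotient_module[OF N] zero M.a_ac)
  then show ?thesis
  proof (intro moduleI)
    show "cring R" by (rule R.cring_axioms)
  qed (auto simp: quotient_module_carrier smult_quotient_module[OF N] add_quotient_module[OF N]
      smult_l_distr smult_r_distr smult_assoc1)
qed

end

section \<open>Bases with three elements\<close>

lemma (in vectorspace) basis_of_three:
  assumes x: "x \<in> carrier V" and y: "y \<in> carrier V" and z: "z \<in> carrier V"
    and gen: "\<And>v. v \<in> carrier V \<Longrightarrow> \<exists>a\<in>carrier K. \<exists>b\<in>carrier K. \<exists>c\<in>carrier K.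
        v = a \<odot>\<^bsub>V\<^esub> x \<oplus>\<^bsub>V\<^esub> (b \<odot>\<^bsub>V\<^esub> y \<oplus>\<^bsub>V\<^esub> c \<odot>\<^bsub>V\<^esub> z)"
    and indep: "\<And>a b c. \<lbrakk>a \<in> carrier K; b \<in> carrier K; c \<in> carrier K;
        a \<odot>\<^bsub>V\<^esub> x \<oplus>\<^bsub>V\<^esub> (b \<odot>\<^bsub>V\<^esub> y \<oplus>\<^bsub>V\<^esub> c \<odot>\<^bsub>V\<^esub> z) = \<zero>\<^bsub>V\<^esub>\<rbrakk> \<Longrightarrow>
        a = \<zero>\<^bsub>K\<^esub> \<and> b = \<zero>\<^bsub>K\<^esub> \<and> c = \<zero>\<^bsub>K\<^esub>"
  shows "fin_dim" and "dim = 3" and "span {x, y, z} = carrier V"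
proof -
  \<comment> \<open>Two equal vectors would satisfy a relation with coefficients 1 and -1, which
    \<open>indep\<close> forbids. Hence the three vectors are distinct and the set has cardinality
    3.\<close>
  have neg: "\<one>\<^bsub>K\<^esub> \<odot>\<^bsub>V\<^esub> v \<oplus>\<^bsub>V\<^esub> (\<ominus>\<^bsub>K\<^esub> \<one>\<^bsub>K\<^esub>) \<odot>\<^bsub>V\<^esub> v = \<zero>\<^bsub>V\<^esub>" if "v \<in> carrier V" for v
    using that smult_l_minus[of "\<one>\<^bsub>K\<^esub>" v] by (simp add: M.r_neg)
  have xy: "x \<noteq> y"
    using indep[of "\<one>\<^bsub>K\<^esub>" "\<ominus>\<^bsub>K\<^esub> \<one>\<^bsub>K\<^esub>" "\<zero>\<^bsub>K\<^esub>"] neg[OF y] x y z by auto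
  have xz: "x \<noteq> z"
    using indep[of "\<one>\<^bsub>K\<^esub>" "\<zero>\<^bsub>K\<^esub>" "\<ominus>\<^bsub>K\<^esub> \<one>\<^bsub>K\<^esub>"] neg[OF z] x y z by auto
  have yz: "y \<noteq> z"
    using indep[of "\<zero>\<^bsub>K\<^esub>" "\<one>\<^bsub>K\<^esub>" "\<ominus>\<^bsub>K\<^esub> \<one>\<^bsub>K\<^esub>"] neg[OF z] x y z by auto
  have lin: "lincomb f {x, y, z} = f x \<odot>\<^bsub>V\<^esub> x \<oplus>\<^bsub>V\<^esub> (f y \<odot>\<^bsub>V\<^esub> y \<oplus>\<^bsub>V\<^esub> f z \<odot>\<^bsub>V\<^esub> z)"
    if "f \<in> {x, y, z} \<rightarrow> carrier K" for f
    using that x y z xy xz yz by (simp add: lincomb_def M.finsum_insert Pi_def)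
  have sub: "{x, y, z} \<subseteq> carrier V" using x y z by simp
  have "v \<in> span {x, y, z}" if v: "v \<in> carrier V" for v
  proof -
    obtain a b c where abc: "a \<in> carrier K" "b \<in> carrier K" "c \<in> carrier K"
      "v = a \<odot>\<^bsub>V\<^esub> x \<oplus>\<^bsub>V\<^esub> (b \<odot>\<^bsub>V\<^esub> y \<oplus>\<^bsub>V\<^esub> c \<odot>\<^bsub>V\<^esub> z)"
      using gen[OF v] by blast
    let ?f = "\<lambda>w. if w = x then a else if w = y then b else c"
    have "?f \<in> {x, y, z} \<rightarrow> carrier K" using abc by auto
    moreover from lin[OF this] have "v = lincomb ?f {x, y, z}"
      using abc xy xz yz by simp
    ultimately show ?thesis unfolding span_def by blast
  qed
  then show span: "span {x, y, z} = carrier V"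
    using span_is_subset2[OF sub] by blast
  have "lin_indpt {x, y, z}"
  proof
    assume "lin_dep {x, y, z}"
    then obtain f v where f: "f \<in> {x, y, z} \<rightarrow> carrier K" and "lincomb f {x, y, z} = \<zero>\<^bsub>V\<^esub>"
      and v: "v \<in> {x, y, z}" "f v \<noteq> \<zero>\<^bsub>K\<^esub>"
      using finite_lin_dep[OF _ _ sub] by blast
    then show False
      using lin[OF f] indep[of "f x" "f y" "f z"] by auto
  qed
  then have "basis {x, y, z}" using span sub by (simp add: basis_def)
  from dim_basis[OF _ this] show "dim = 3" using xy xz yz by simp
  show fin_dim unfolding fin_dim_def using span sub
    by (intro exI[of _ "{x, y, z}"] conjI) simp_all
qed

section \<open>Second cohomology as a vector space\<close>

lemma complex_field_simps [simp]:
  "carrier complex_field = UNIV" "\<zero>\<^bsub>complex_field\<^esub> = 0" "\<one>\<^bsub>complex_field\<^esub> = 1"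
  "x \<oplus>\<^bsub>complex_field\<^esub> y = x + y" "x \<otimes>\<^bsub>complex_field\<^esub> y = x * y"
  by (simp_all add: complex_field_def)

lemma cocycle_space_simps [simp]:
  "carrier (cocycle_space L) = two_cocycles L"
  "\<zero>\<^bsub>cocycle_space L\<^esub> = (\<lambda>x y. 0)"
  "C \<oplus>\<^bsub>cocycle_space L\<^esub> D = (\<lambda>x y. C x y + D x y)"
  "a \<odot>\<^bsub>cocycle_space L\<^esub> C = (\<lambda>x y. a * C x y)"
  by (simp_all add: cocycle_space_def)

lemma linear_functional_add:
  "f \<in> linear_functionals L \<Longrightarrow> x \<in> carrier L \<Longrightarrow> y \<in> carrier L \<Longrightarrow> f (x \<oplus>\<^bsub>L\<^esub> y) = f x + f y"
  by (simp add: linear_functionals_def)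

lemma linear_functional_smult:
  "f \<in> linear_functionals L \<Longrightarrow> x \<in> carrier L \<Longrightarrow> f (a \<odot>\<^bsub>L\<^esub> x) = a * f x"
  by (simp add: linear_functionals_def)

lemma skew_bilinear_formI:
  assumes "\<And>x y. x \<notin> carrier L \<or> y \<notin> carrier L \<Longrightarrow> C x y = 0"
    and "\<And>x y z. \<lbrakk>x \<in> carrier L; y \<in> carrier L; z \<in> carrier L\<rbrakk> \<Longrightarrow> C (x \<oplus>\<^bsub>L\<^esub> y) z = C x z + C y z"
    and "\<And>x y z. \<lbrakk>x \<in> carrier L; y \<in> carrier L; z \<in> carrier L\<rbrakk> \<Longrightarrow> C x (y \<oplus>\<^bsub>L\<^esub> z) = C x y + C x z"
    and "\<And>a x y. \<lbrakk>x \<in> carrier L; y \<in> carrier L\<rbrakk> \<Longrightarrow> C (a \<odot>\<^bsub>L\<^esub> x) y = a * C x y"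
    and "\<And>a x y. \<lbrakk>x \<in> carrier L; y \<in> carrier L\<rbrakk> \<Longrightarrow> C x (a \<odot>\<^bsub>L\<^esub> y) = a * C x y"
    and "\<And>x y. \<lbrakk>x \<in> carrier L; y \<in> carrier L\<rbrakk> \<Longrightarrow> C x y = - C y x"
  shows "C \<in> skew_bilinear_forms L"
  unfolding skew_bilinear_forms_def by (intro CollectI conjI allI ballI impI) (fact assms)+

text \<open>Skew symmetry carries additivity and homogeneity from the first argument to the second.
  The module structure supplies closure of the carrier, and \<open>carrier R = UNIV\<close> admits
  every scalar.\<close>

lemma skew_bilinear_formI_left:
  assumes "\<And>x y. x \<notin> carrier L \<or> y \<notin> carrier L \<Longrightarrow> C x y = 0"
    and add: "\<And>x y z. \<lbrakk>x \<in> carrier L; y \<in> carrier L; z \<in> carrier L\<rbrakk> \<Longrightarrow>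
      C (x \<oplus>\<^bsub>L\<^esub> y) z = C x z + C y z"
    and smult: "\<And>a x y. \<lbrakk>x \<in> carrier L; y \<in> carrier L\<rbrakk> \<Longrightarrow> C (a \<odot>\<^bsub>L\<^esub> x) y = a * C x y"
    and skew: "\<And>x y. \<lbrakk>x \<in> carrier L; y \<in> carrier L\<rbrakk> \<Longrightarrow> C x y = - C y x"
    and "module R L" and R: "carrier R = UNIV"
  shows "C \<in> skew_bilinear_forms L"
proof (rule skew_bilinear_formI)
  interpret module R L by fact
  fix x y z assume "x \<in> carrier L" "y \<in> carrier L" "z \<in> carrier L"
  then show "C x (y \<oplus>\<^bsub>L\<^esub> z) = C x y + C x z"
    using skew[of x "y \<oplus>\<^bsub>L\<^esub> z"] add[of y z x] skew[of x y] skew[of x z] by simp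
next
  interpret module R L by fact
  fix a x y assume "x \<in> carrier L" "y \<in> carrier L"
  then show "C x (a \<odot>\<^bsub>L\<^esub> y) = a * C x y"
    using skew[of x "a \<odot>\<^bsub>L\<^esub> y"] smult[of y x a] skew[of x y] R by simp
qed (fact assms)+

lemma skew_bilinear_formD:
  assumes "C \<in> skew_bilinear_forms L"
  shows "x \<notin> carrier L \<or> y \<notin> carrier L \<Longrightarrow> C x y = 0"
    and "\<lbrakk>x \<in> carrier L; y \<in> carrier L; z \<in> carrier L\<rbrakk> \<Longrightarrow> C (x \<oplus>\<^bsub>L\<^esub> y) z = C x z + C y z"
    and "\<lbrakk>x \<in> carrier L; y \<in> carrier L; z \<in> carrier L\<rbrakk> \<Longrightarrow> C x (y \<oplus>\<^bsub>L\<^esub> z) = C x y + C x z"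
    and "\<lbrakk>x \<in> carrier L; y \<in> carrier L\<rbrakk> \<Longrightarrow> C (a \<odot>\<^bsub>L\<^esub> x) y = a * C x y"
    and "\<lbrakk>x \<in> carrier L; y \<in> carrier L\<rbrakk> \<Longrightarrow> C x (a \<odot>\<^bsub>L\<^esub> y) = a * C x y"
    and "\<lbrakk>x \<in> carrier L; y \<in> carrier L\<rbrakk> \<Longrightarrow> C x y = - C y x"
  using assms unfolding skew_bilinear_forms_def mem_Collect_eq by meson+

lemma two_cocycle_skew_bilinear: "C \<in> two_cocycles L \<Longrightarrow> C \<in> skew_bilinear_forms L"
  by (simp add: two_cocycles_def)

lemma two_cocycle_jacobi:
  assumes "C \<in> two_cocycles L" and "x \<in> carrier L" and "y \<in> carrier L" and "z \<in> carrier L"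
  shows "C (lie_bracket L x y) z + C (lie_bracket L y z) x + C (lie_bracket L z x) y = 0"
  using assms by (simp add: two_cocycles_def)

lemma two_cocyclesI:
  assumes "C \<in> skew_bilinear_forms L"
    and "\<And>x y z. \<lbrakk>x \<in> carrier L; y \<in> carrier L; z \<in> carrier L\<rbrakk> \<Longrightarrow>
      C (lie_bracket L x y) z + C (lie_bracket L y z) x + C (lie_bracket L z x) y = 0"
  shows "C \<in> two_cocycles L"
  using assms unfolding two_cocycles_def by blast

lemma two_cocycles_add:
  assumes C: "C \<in> two_cocycles L" and D: "D \<in> two_cocycles L"
  shows "(\<lambda>x y. C x y + D x y) \<in> two_cocycles L"
proof (rule two_cocyclesI)
  note bilin = C[THEN two_cocycle_skew_bilinear] D[THEN two_cocycle_skew_bilinear]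
  show "(\<lambda>x y. C x y + D x y) \<in> skew_bilinear_forms L"
  proof (rule skew_bilinear_formI)
    fix x y assume "x \<in> carrier L" "y \<in> carrier L"
    then show "C x y + D x y = - (C y x + D y x)"
      using bilin[THEN skew_bilinear_formD(6), of x y] by simp
  qed (auto simp: bilin[THEN skew_bilinear_formD(1)] bilin[THEN skew_bilinear_formD(2)]
      bilin[THEN skew_bilinear_formD(3)] bilin[THEN skew_bilinear_formD(4)]
      bilin[THEN skew_bilinear_formD(5)] distrib_left)
  fix x y z assume "x \<in> carrier L" "y \<in> carrier L" "z \<in> carrier L"
  from arg_cong2[OF two_cocycle_jacobi[OF C this] two_cocycle_jacobi[OF D this], of "(+)"]
  show "C (lie_bracket L x y) z + D (lie_bracket L x y) z
      + (C (lie_bracket L y z) x + D (lie_bracket L y z) x)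
      + (C (lie_bracket L z x) y + D (lie_bracket L z x) y) = 0"
    by (simp only: ac_simps add_0_right)
qed

lemma two_cocycles_smult:
  assumes C: "C \<in> two_cocycles L"
  shows "(\<lambda>x y. a * C x y) \<in> two_cocycles L"
proof (rule two_cocyclesI)
  note bilin = C[THEN two_cocycle_skew_bilinear]
  show "(\<lambda>x y. a * C x y) \<in> skew_bilinear_forms L"
  proof (rule skew_bilinear_formI)
    fix x y assume "x \<in> carrier L" "y \<in> carrier L"
    then show "a * C x y = - (a * C y x)"
      using skew_bilinear_formD(6)[OF bilin, of x y] by simp
  qed (auto simp: skew_bilinear_formD(1-5)[OF bilin] distrib_left)
  fix x y z assume "x \<in> carrier L" "y \<in> carrier L" "z \<in> carrier L"
  from arg_cong[OF two_cocycle_jacobi[OF C this], of "(*) a"]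
  show "a * C (lie_bracket L x y) z + a * C (lie_bracket L y z) x + a * C (lie_bracket L z x) y = 0"
    by (simp only: distrib_left mult_zero_right)
qed

lemma vectorspace_cocycle_space: "vectorspace complex_field (cocycle_space L)"
proof (rule vs_criteria)
  have "(\<lambda>x y. 0) \<in> two_cocycles L"
    by (intro two_cocyclesI skew_bilinear_formI) simp_all
  then show "\<zero>\<^bsub>cocycle_space L\<^esub> \<in> carrier (cocycle_space L)" by simp
  show "\<forall>C\<in>carrier (cocycle_space L). \<exists>D\<in>carrier (cocycle_space L).
      C \<oplus>\<^bsub>cocycle_space L\<^esub> D = \<zero>\<^bsub>cocycle_space L\<^esub>"
  proof
    fix C assume "C \<in> carrier (cocycle_space L)"
    then have "(\<lambda>x y. (-1) * C x y) \<in> two_cocycles L" by (intro two_cocycles_smult) simp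
    then show "\<exists>D\<in>carrier (cocycle_space L). C \<oplus>\<^bsub>cocycle_space L\<^esub> D = \<zero>\<^bsub>cocycle_space L\<^esub>"
      by (intro bexI[of _ "\<lambda>x y. (-1) * C x y"]) auto
  qed
qed (auto simp: field_complex_field two_cocycles_add two_cocycles_smult algebra_simps)

section \<open>Coboundaries inside the space of cocycles, and the quotient\<close>

lemma two_coboundaryI:
  "f \<in> linear_functionals L \<Longrightarrow>
    (\<lambda>x y. if x \<in> carrier L \<and> y \<in> carrier L then f (lie_bracket L x y) else 0) \<in> two_coboundaries L"
  unfolding two_coboundaries_def by blast

text \<open>A coboundary gets its skew symmetry from \<open>bracket_self\<close> and its cocycle
  identity from \<open>jacobi\<close>. Sums and multiples of coboundaries come from sums and
  multiples of functionals.\<close>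

lemma submodule_two_coboundaries:
  assumes "lie_algebra complex_field L"
  shows "submodule complex_field (two_coboundaries L) (cocycle_space L)"
proof -
  interpret lie_algebra complex_field L by fact
  interpret Z: vectorspace complex_field "cocycle_space L" by (rule vectorspace_cocycle_space)
  have "C \<in> two_cocycles L" if "C \<in> two_coboundaries L" for C
  proof -
    obtain f where f: "f \<in> linear_functionals L" and
      C: "C = (\<lambda>x y. if x \<in> carrier L \<and> y \<in> carrier L then f (lie_bracket L x y) else 0)"
      using \<open>C \<in> two_coboundaries L\<close> unfolding two_coboundaries_def by blast
    have f0: "f \<zero>\<^bsub>L\<^esub> = 0"
      using linear_functional_add[OF f, of "\<zero>\<^bsub>L\<^esub>" "\<zero>\<^bsub>L\<^esub>"] by simp
    note f_simps = linear_functional_add[OF f] linear_functional_smult[OF f] bracket_closed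
    have "C \<in> skew_bilinear_forms L"
    proof (rule skew_bilinear_formI_left)
      fix x y assume x: "x \<in> carrier L" and y: "y \<in> carrier L"
      \<comment> \<open>Polarization: the bracket of a sum with itself is zero, and after expansion
        only the two mixed terms survive.\<close>
      have "0 = f (lie_bracket L (x \<oplus>\<^bsub>L\<^esub> y) (x \<oplus>\<^bsub>L\<^esub> y))"
        using x y f0 by (simp add: bracket_self)
      also have "\<dots> = f (lie_bracket L x x) + f (lie_bracket L x y)
          + (f (lie_bracket L y x) + f (lie_bracket L y y))"
        using x y by (simp add: bracket_add_left bracket_add_right f_simps)
      finally have "f (lie_bracket L x y) + f (lie_bracket L y x) = 0"
        using x y by (simp add: bracket_self f0)
      then show "C x y = - C y x" using x y by (simp add: C eq_neg_iff_add_eq_0)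
    next
      show "module complex_field L" by (rule module_axioms)
    qed (auto simp: C bracket_add_left bracket_smult_left f_simps)
    moreover have "C (lie_bracket L x y) z + C (lie_bracket L y z) x + C (lie_bracket L z x) y = 0"
      if "x \<in> carrier L" "y \<in> carrier L" "z \<in> carrier L" for x y z
    proof -
      have "f (lie_bracket L (lie_bracket L x y) z \<oplus>\<^bsub>L\<^esub> (lie_bracket L (lie_bracket L y z) x
        \<oplus>\<^bsub>L\<^esub> lie_bracket L (lie_bracket L z x) y)) = 0"
        using jacobi[OF that] f0 by simp
      then show ?thesis using that by (simp add: f_simps C add.assoc)
    qed
    ultimately show ?thesis by (rule two_cocyclesI)
  qed
  moreover have "(\<lambda>x y. C x y + D x y) \<in> two_coboundaries L"
    if CD: "C \<in> two_coboundaries L" "D \<in> two_coboundaries L" for C D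
  proof -
    obtain f g where f: "f \<in> linear_functionals L" and g: "g \<in> linear_functionals L"
      and C: "C = (\<lambda>x y. if x \<in> carrier L \<and> y \<in> carrier L then f (lie_bracket L x y) else 0)"
      and D: "D = (\<lambda>x y. if x \<in> carrier L \<and> y \<in> carrier L then g (lie_bracket L x y) else 0)"
      using CD unfolding two_coboundaries_def by blast
    have "(\<lambda>x. f x + g x) \<in> linear_functionals L"
      using f g by (simp add: linear_functionals_def algebra_simps)
    \<comment> \<open>A sum of two guarded functions is not literally a guarded function, so
      membership is transported along an extensional equality.\<close>
    from two_coboundaryI[OF this] show ?thesis
      unfolding C D by (rule back_subst[of "\<lambda>C. C \<in> two_coboundaries L"]) (auto simp: fun_eq_iff)
  qed
  moreover have "(\<lambda>x y. a * C x y) \<in> two_coboundaries L"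
    if C: "C \<in> two_coboundaries L" for a C
  proof -
    obtain f where f: "f \<in> linear_functionals L"
      and C_eq: "C = (\<lambda>x y. if x \<in> carrier L \<and> y \<in> carrier L then f (lie_bracket L x y) else 0)"
      using C unfolding two_coboundaries_def by blast
    have "(\<lambda>x. a * f x) \<in> linear_functionals L"
      using f by (simp add: linear_functionals_def algebra_simps)
    from two_coboundaryI[OF this] show ?thesis
      unfolding C_eq by (rule back_subst[of "\<lambda>C. C \<in> two_coboundaries L"]) (auto simp: fun_eq_iff)
  qed
  moreover have "(\<lambda>x y. 0) \<in> two_coboundaries L"
    using two_coboundaryI[of "\<lambda>x. 0" L] by (simp add: linear_functionals_def)
  ultimately show ?thesis
    by unfold_locales auto
qed

text \<open>Translates a basis of the quotient into statements about forms: spanning becomes a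
  decomposition modulo coboundaries, and independence says that only the trivial combination is a
  coboundary. Both conditions mention only arguments in the carrier.\<close>

lemma second_cohomology_basis:
  fixes L :: "(complex, 'a, 'm) lie_alg_scheme"
  assumes L: "lie_algebra complex_field L"
    and C: "C1 \<in> two_cocycles L" "C2 \<in> two_cocycles L" "C3 \<in> two_cocycles L"
    and gen: "\<And>C. C \<in> two_cocycles L \<Longrightarrow> \<exists>a b c f. f \<in> linear_functionals L \<and>
        (\<forall>x\<in>carrier L. \<forall>y\<in>carrier L.
          C x y = a * C1 x y + (b * C2 x y + c * C3 x y) + f (lie_bracket L x y))"
    and indep: "\<And>a b c f. f \<in> linear_functionals L \<Longrightarrow>
        \<forall>x\<in>carrier L. \<forall>y\<in>carrier L.
          a * C1 x y + (b * C2 x y + c * C3 x y) = f (lie_bracket L x y) \<Longrightarrow>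
        a = 0 \<and> b = 0 \<and> c = 0"
  shows "vectorspace complex_field (second_cohomology L)"
    and "vectorspace.fin_dim complex_field (second_cohomology L)"
    and "vectorspace.dim complex_field (second_cohomology L) = 3"
    and "module.span complex_field (second_cohomology L)
      {cohomology_class L C1, cohomology_class L C2, cohomology_class L C3}
      = carrier (second_cohomology L)"
proof -
  interpret Z: vectorspace complex_field "cocycle_space L" by (rule vectorspace_cocycle_space)
  have B: "submodule complex_field (two_coboundaries L) (cocycle_space L)"
    using L by (rule submodule_two_coboundaries)
  show H: "vectorspace complex_field (second_cohomology L)"
    unfolding second_cohomology_def vectorspace_def
    using Z.module_quotient_module[OF B] field_complex_field by simp
  interpret H: vectorspace complex_field "second_cohomology L" by fact
  have carrier: "carrier (second_cohomology L) = cohomology_class L ` two_cocycles L"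
    using Z.quotient_module_carrier[of "two_coboundaries L"]
    by (auto simp: second_cohomology_def cohomology_class_def)
  have lin: "a \<odot>\<^bsub>second_cohomology L\<^esub> cohomology_class L C1 \<oplus>\<^bsub>second_cohomology L\<^esub>
      (b \<odot>\<^bsub>second_cohomology L\<^esub> cohomology_class L C2 \<oplus>\<^bsub>second_cohomology L\<^esub>
       c \<odot>\<^bsub>second_cohomology L\<^esub> cohomology_class L C3) =
      cohomology_class L (\<lambda>x y. a * C1 x y + (b * C2 x y + c * C3 x y))" for a b c
    using C by (simp add: second_cohomology_def cohomology_class_def Z.smult_quotient_module[OF B]
        Z.add_quotient_module[OF B] two_cocycles_add two_cocycles_smult)
  have zero: "cohomology_class L C = \<zero>\<^bsub>second_cohomology L\<^esub> \<longleftrightarrow> C \<in> two_coboundaries L"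
    if "C \<in> two_cocycles L" for C
    using that Z.coset_eq_zero_iff[OF B, of C] by (simp add: second_cohomology_def cohomology_class_def)
  have cl: "cohomology_class L C \<in> carrier (second_cohomology L)" if "C \<in> two_cocycles L" for C
    using that carrier by simp
  have gen': "\<exists>a\<in>carrier complex_field. \<exists>b\<in>carrier complex_field. \<exists>c\<in>carrier complex_field.
      v = a \<odot>\<^bsub>second_cohomology L\<^esub> cohomology_class L C1 \<oplus>\<^bsub>second_cohomology L\<^esub>
        (b \<odot>\<^bsub>second_cohomology L\<^esub> cohomology_class L C2 \<oplus>\<^bsub>second_cohomology L\<^esub>
         c \<odot>\<^bsub>second_cohomology L\<^esub> cohomology_class L C3)"
    if v: "v \<in> carrier (second_cohomology L)" for v
  proof -
    obtain D where D: "D \<in> two_cocycles L" and vD: "v = cohomology_class L D"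
      using v carrier by auto
    obtain a b c f where f: "f \<in> linear_functionals L" and
      eq: "\<And>x y. x \<in> carrier L \<Longrightarrow> y \<in> carrier L \<Longrightarrow>
          D x y = a * C1 x y + (b * C2 x y + c * C3 x y) + f (lie_bracket L x y)"
      using gen[OF D] by blast
    let ?S = "\<lambda>x y. a * C1 x y + (b * C2 x y + c * C3 x y)"
    let ?f = "\<lambda>x y. if x \<in> carrier L \<and> y \<in> carrier L then f (lie_bracket L x y) else 0"
    have S: "?S \<in> two_cocycles L" using C by (intro two_cocycles_add two_cocycles_smult)
    \<comment> \<open>Off the carrier all these forms vanish, so agreement on the carrier is
      equality of functions.\<close>
    have "D = (\<lambda>x y. ?f x y + ?S x y)"
      using eq C D[THEN two_cocycle_skew_bilinear] C[THEN two_cocycle_skew_bilinear]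
      by (auto simp: fun_eq_iff skew_bilinear_formD(1))
    then have "D \<in> two_coboundaries L +>\<^bsub>cocycle_space L\<^esub> ?S"
      using two_coboundaryI[OF f] by (force simp: a_r_coset_def')
    then have "cohomology_class L ?S = v"
      unfolding vD cohomology_class_def
      using Z.a_repr_independence[of D "two_coboundaries L" ?S] S
        Z.submodule_abelian_subgroup[OF B, THEN abelian_subgroup.axioms(1), THEN additive_subgroup.a_subgroup]
      by simp
    then show ?thesis using lin by force
  qed
  have indep': "a = \<zero>\<^bsub>complex_field\<^esub> \<and> b = \<zero>\<^bsub>complex_field\<^esub> \<and> c = \<zero>\<^bsub>complex_field\<^esub>"
    if "a \<odot>\<^bsub>second_cohomology L\<^esub> cohomology_class L C1 \<oplus>\<^bsub>second_cohomology L\<^esub>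
      (b \<odot>\<^bsub>second_cohomology L\<^esub> cohomology_class L C2 \<oplus>\<^bsub>second_cohomology L\<^esub>
       c \<odot>\<^bsub>second_cohomology L\<^esub> cohomology_class L C3) = \<zero>\<^bsub>second_cohomology L\<^esub>" for a b c
  proof -
    \<comment> \<open>The zero of the quotient is the set of coboundaries, so a vanishing
      combination of classes puts the same combination of cocycles there.\<close>
    have "(\<lambda>x y. a * C1 x y + (b * C2 x y + c * C3 x y)) \<in> two_coboundaries L"
      using that C by (simp add: lin zero two_cocycles_add two_cocycles_smult)
    then obtain f where "f \<in> linear_functionals L" and
      eq: "(\<lambda>x y. a * C1 x y + (b * C2 x y + c * C3 x y)) =
        (\<lambda>x y. if x \<in> carrier L \<and> y \<in> carrier L then f (lie_bracket L x y) else 0)"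
      unfolding two_coboundaries_def by blast
    moreover have "a * C1 x y + (b * C2 x y + c * C3 x y) = f (lie_bracket L x y)"
      if "x \<in> carrier L" "y \<in> carrier L" for x y
      using that fun_cong[OF fun_cong[OF eq, of x], of y] by simp
    ultimately show ?thesis using indep[of f a b c] by simp
  qed
  show "vectorspace.fin_dim complex_field (second_cohomology L)"
    and "vectorspace.dim complex_field (second_cohomology L) = 3"
    and "module.span complex_field (second_cohomology L)
      {cohomology_class L C1, cohomology_class L C2, cohomology_class L C3}
      = carrier (second_cohomology L)"
    using H.basis_of_three[OF C[THEN cl] gen' indep'] by blast+
qed

section \<open>Functionals and forms on the solenoidal algebra\<close>

definition lin_ext :: "('a \<Rightarrow> complex) \<Rightarrow> ('a \<Rightarrow>\<^sub>0 complex) \<Rightarrow> complex" where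
  "lin_ext p f = (\<Sum>\<alpha>\<in>Poly_Mapping.keys f. Poly_Mapping.lookup f \<alpha> * p \<alpha>)"

text \<open>Supports can shrink under addition or scaling. Indices outside the support contribute 0,
  so sums for different polynomials can be compared over a common index set.\<close>

lemma lin_ext_superset:
  assumes "finite S" and "Poly_Mapping.keys f \<subseteq> S"
  shows "lin_ext p f = (\<Sum>\<alpha>\<in>S. Poly_Mapping.lookup f \<alpha> * p \<alpha>)"
  unfolding lin_ext_def using assms by (intro sum.mono_neutral_left) (auto simp: in_keys_iff)

lemma lin_ext_add: "lin_ext p (f + g) = lin_ext p f + lin_ext p g"
proof -
  let ?S = "Poly_Mapping.keys f \<union> Poly_Mapping.keys g"
  have "lin_ext p (f + g) = (\<Sum>\<alpha>\<in>?S. Poly_Mapping.lookup (f + g) \<alpha> * p \<alpha>)"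
    using Poly_Mapping.keys_add[of f g] by (intro lin_ext_superset) auto
  also have "\<dots> = (\<Sum>\<alpha>\<in>?S. Poly_Mapping.lookup f \<alpha> * p \<alpha>) + (\<Sum>\<alpha>\<in>?S. Poly_Mapping.lookup g \<alpha> * p \<alpha>)"
    by (simp add: lookup_add distrib_right sum.distrib)
  also have "\<dots> = lin_ext p f + lin_ext p g"
    using lin_ext_superset[of ?S f p] lin_ext_superset[of ?S g p] by simp
  finally show ?thesis .
qed

lemma lin_ext_scale: "lin_ext p (laurent_scale c f) = c * lin_ext p f"
proof -
  have "lin_ext p (laurent_scale c f)
      = (\<Sum>\<alpha>\<in>Poly_Mapping.keys f. Poly_Mapping.lookup (laurent_scale c f) \<alpha> * p \<alpha>)"
    by (rule lin_ext_superset) (auto simp: in_keys_iff lookup_scale)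
  then show ?thesis
    by (simp add: lin_ext_def lookup_scale sum_distrib_left mult.assoc)
qed

lemma lin_ext_fun_linear:
  "lin_ext (\<lambda>\<alpha>. p \<alpha> + q \<alpha>) f = lin_ext p f + lin_ext q f"
  "lin_ext (\<lambda>\<alpha>. c * p \<alpha>) f = c * lin_ext p f"
  by (simp_all add: lin_ext_def distrib_left sum.distrib sum_distrib_left mult.left_commute)

lemma lin_ext_monom [simp]: "lin_ext p (Poly_Mapping.single \<alpha> 1) = p \<alpha>"
  by (simp add: lin_ext_def)

lemma lin_ext_zero [simp]: "lin_ext p 0 = 0"
  by (simp add: lin_ext_def)

text \<open>As an iterated extension, the double sum gets its bilinearity from the linearity of
  \<open>lin_ext\<close> in the polynomial and in the prescribed values.\<close>

lemma pair_sum_eq_lin_ext: "pair_sum b f g = lin_ext (\<lambda>\<alpha>. lin_ext (b \<alpha>) g) f"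
  by (simp add: pair_sum_def lin_ext_def sum_distrib_left mult.assoc)

lemma pair_sum_swap: "pair_sum b f g = pair_sum (\<lambda>\<alpha> \<beta>. b \<beta> \<alpha>) g f"
  unfolding pair_sum_def by (subst sum.swap) (simp add: mult_ac)

lemma pair_sum_linear:
  "pair_sum b (f + f') g = pair_sum b f g + pair_sum b f' g"
  "pair_sum b (laurent_scale c f) g = c * pair_sum b f g"
  "pair_sum b g (f + f') = pair_sum b g f + pair_sum b g f'"
  "pair_sum b g (laurent_scale c f) = c * pair_sum b g f"
  by (simp_all add: pair_sum_eq_lin_ext lin_ext_add lin_ext_scale lin_ext_fun_linear)

lemma pair_sum_skew:
  assumes "\<And>\<alpha> \<beta>. b \<alpha> \<beta> = - b \<beta> \<alpha>"
  shows "pair_sum b f g = - pair_sum b g f"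
proof -
  have "pair_sum b f g = pair_sum (\<lambda>\<alpha> \<beta>. - b \<alpha> \<beta>) g f"
    by (subst pair_sum_swap) (simp only: assms[symmetric])
  then show ?thesis by (simp add: pair_sum_def sum_negf)
qed

text \<open>The functional with prescribed values \<open>p\<close> on the \<open>e_gen\<close> and
  \<open>q\<close> on the \<open>h_gen\<close>. A derivation enters through
  \<open>dmu_coeff\<close>, so the values are attained when \<mu> is generic.\<close>

definition functional_of_values where
  "functional_of_values \<mu> p q X = lin_ext p (dmu_coeff \<mu> (fst X)) + lin_ext q (snd X)"

lemma functional_of_values_linear:
  assumes "generic \<mu>"
  shows "functional_of_values \<mu> p q \<in> linear_functionals (WA \<mu>)"
  unfolding linear_functionals_def
  by (auto elim!: WA_carrier_cases simp: functional_of_values_def WA_ops dmu_coeff_eq[OF assms]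
      lin_ext_add lin_ext_scale distrib_left)

lemma functional_of_values_basis:
  assumes "generic \<mu>"
  shows "functional_of_values \<mu> p q (e_gen \<mu> \<alpha>) = p \<alpha>"
    and "functional_of_values \<mu> p q (h_gen \<alpha>) = q \<alpha>"
  by (simp_all add: functional_of_values_def e_gen_def h_gen_def dmu_coeff_eq[OF assms]
      dmu_coeff_zero[OF assms])

text \<open>Exchanging the arguments swaps the two mixed sums, which have opposite signs. Skewness
  is therefore only a condition on \<open>ee\<close> and \<open>hh\<close>.\<close>

lemma form_of_values_skew_bilinear:
  assumes "generic \<mu>" and ee: "\<And>\<alpha> \<beta>. ee \<alpha> \<beta> = - ee \<beta> \<alpha>" and hh: "\<And>\<alpha> \<beta>. hh \<alpha> \<beta> = - hh \<beta> \<alpha>"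
  shows "form_of_values \<mu> ee eh hh \<in> skew_bilinear_forms (WA \<mu>)"
proof (rule skew_bilinear_formI_left)
  interpret lie_algebra complex_field "WA \<mu>" by (rule lie_algebra_WA)
  show "module complex_field (WA \<mu>)" by (rule module_axioms)
  let ?F = "form_of_values \<mu> ee eh hh"
  have eval: "?F (\<lambda>u. f * dmu \<mu> u, g) (\<lambda>u. f' * dmu \<mu> u, g')
      = pair_sum ee f f' + pair_sum eh f g' - pair_sum eh f' g + pair_sum hh g g'" for f g f' g'
    by (simp add: form_of_values_def dmu_coeff_eq[OF assms(1)] WA_carrierI)
  fix x y assume xy: "x \<in> carrier (WA \<mu>)" "y \<in> carrier (WA \<mu>)"
  obtain f g f' g' where X: "x = (\<lambda>u. f * dmu \<mu> u, g)" "y = (\<lambda>u. f' * dmu \<mu> u, g')"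
    using xy by (auto elim!: WA_carrier_cases)
  show "?F x y = - ?F y x"
    unfolding X eval using pair_sum_skew[of ee f f', OF ee] pair_sum_skew[of hh g g', OF hh] by simp
  show "?F (a \<odot>\<^bsub>WA \<mu>\<^esub> x) y = a * ?F x y" for a
    unfolding X WA_ops eval pair_sum_linear by (simp add: algebra_simps)
  fix z assume "z \<in> carrier (WA \<mu>)"
  then obtain f'' g'' where Z: "z = (\<lambda>u. f'' * dmu \<mu> u, g'')" by (rule WA_carrier_cases)
  show "?F (x \<oplus>\<^bsub>WA \<mu>\<^esub> y) z = ?F x z + ?F y z"
    unfolding X Z WA_ops eval pair_sum_linear by (simp add: algebra_simps)
qed (auto simp: form_of_values_def)

section \<open>Functionals and forms tested on the generators\<close>

lemma WA_functional_eq_zero: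
  fixes \<mu> :: "complex ^ 'n::finite"
  assumes F: "F \<in> linear_functionals (WA \<mu>)"
    and e: "\<And>\<alpha>. F (e_gen \<mu> \<alpha>) = 0" and h: "\<And>\<alpha>. F (h_gen \<alpha>) = 0"
    and X: "X \<in> carrier (WA \<mu>)"
  shows "F X = 0"
proof -
  let ?X = "\<lambda>f g. (\<lambda>u. f * dmu \<mu> u, g)"
  have add: "F (?X (f + f') (g + g')) = F (?X f g) + F (?X f' g')" for f f' g g'
    using linear_functional_add[OF F WA_carrierI WA_carrierI, of f g f' g'] by (simp only: WA_ops)
  have smult: "F (?X (laurent_scale c f) (laurent_scale c g)) = c * F (?X f g)" for c f g
    using linear_functional_smult[OF F WA_carrierI, of c f g] by (simp only: WA_ops)
  have zero: "F (?X 0 0) = 0"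
    using add[of 0 0 0 0] by simp
  have single: "F (?X (Poly_Mapping.single \<alpha> c) 0) = 0" "F (?X 0 (Poly_Mapping.single \<alpha> c)) = 0" for \<alpha> c
    using smult[of c "laurent_monom \<alpha>" 0] smult[of c 0 "laurent_monom \<alpha>"] e[of \<alpha>] h[of \<alpha>]
    by (simp_all add: mult_single e_gen_def h_gen_eq[of _ \<mu>])
  \<comment> \<open>Every Laurent polynomial is a finite sum of scaled monomials, so these sums
    cover both components. For an infinite index set the sum is 0 by convention.\<close>
  have sums: "F (?X (\<Sum>\<alpha>\<in>S. Poly_Mapping.single \<alpha> (c \<alpha>)) 0) = 0 \<and>
      F (?X 0 (\<Sum>\<alpha>\<in>S. Poly_Mapping.single \<alpha> (c \<alpha>))) = 0" for S and c :: "int ^ 'n \<Rightarrow> complex"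
  proof (induction S rule: infinite_finite_induct)
    case (insert \<alpha> S)
    let ?m = "Poly_Mapping.single \<alpha> (c \<alpha>)" and ?s = "\<Sum>\<alpha>\<in>S. Poly_Mapping.single \<alpha> (c \<alpha>)"
    have "F (?X (?m + ?s) (0 + 0)) = 0" "F (?X (0 + 0) (?m + ?s)) = 0"
      unfolding add using insert.IH single by simp_all
    then show ?case using insert.hyps by simp
  qed (use zero in simp_all)
  obtain f g where fg: "X = ?X f g" using X by (rule WA_carrier_cases)
  have "F (?X (f + 0) (0 + g)) = 0"
    unfolding add using sums[of "Poly_Mapping.lookup f" "Poly_Mapping.keys f"]
      sums[of "Poly_Mapping.lookup g" "Poly_Mapping.keys g"]
    by (simp add: laurent_eq_sum_single)
  then show ?thesis by (simp add: fg)
qed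

lemma linear_functional_of_form:
  assumes C: "C \<in> skew_bilinear_forms L"
  shows "y \<in> carrier L \<Longrightarrow> (\<lambda>x. C x y) \<in> linear_functionals L"
    and "x \<in> carrier L \<Longrightarrow> (\<lambda>y. C x y) \<in> linear_functionals L"
  by (simp_all add: linear_functionals_def skew_bilinear_formD(2-5)[OF C])

lemma linear_functionals_diff:
  assumes "f \<in> linear_functionals L" and "g \<in> linear_functionals L"
  shows "(\<lambda>x. f x - g x) \<in> linear_functionals L"
  using assms by (simp add: linear_functionals_def algebra_simps)

lemma WA_functional_eqI:
  assumes "F \<in> linear_functionals (WA \<mu>)" and "G \<in> linear_functionals (WA \<mu>)"
    and "\<And>\<alpha>. F (e_gen \<mu> \<alpha>) = G (e_gen \<mu> \<alpha>)" and "\<And>\<alpha>. F (h_gen \<alpha>) = G (h_gen \<alpha>)"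
    and "x \<in> carrier (WA \<mu>)"
  shows "F x = G x"
  using WA_functional_eq_zero[OF linear_functionals_diff[OF assms(1,2)]] assms(3-) by simp

text \<open>Linearity is used once per argument: the second is freed while the first is a generator,
  then the first is freed. The pairs (h, e) follow from (e, h) by skewness.\<close>

lemma WA_form_eqI:
  assumes C: "C \<in> skew_bilinear_forms (WA \<mu>)" and D: "D \<in> skew_bilinear_forms (WA \<mu>)"
    and ee: "\<And>\<alpha> \<beta>. C (e_gen \<mu> \<alpha>) (e_gen \<mu> \<beta>) = D (e_gen \<mu> \<alpha>) (e_gen \<mu> \<beta>)"
    and eh: "\<And>\<alpha> \<beta>. C (e_gen \<mu> \<alpha>) (h_gen \<beta>) = D (e_gen \<mu> \<alpha>) (h_gen \<beta>)"
    and hh: "\<And>\<alpha> \<beta>. C (h_gen \<alpha>) (h_gen \<beta>) = D (h_gen \<alpha>) (h_gen \<beta>)"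
    and x: "x \<in> carrier (WA \<mu>)" and y: "y \<in> carrier (WA \<mu>)"
  shows "C x y = D x y"
proof -
  note [simp] = e_gen_in_carrier h_gen_in_carrier
  have he: "C (h_gen \<alpha>) (e_gen \<mu> \<beta>) = D (h_gen \<alpha>) (e_gen \<mu> \<beta>)" for \<alpha> \<beta>
    using skew_bilinear_formD(6)[OF C, of "h_gen \<alpha>" "e_gen \<mu> \<beta>"]
      skew_bilinear_formD(6)[OF D, of "h_gen \<alpha>" "e_gen \<mu> \<beta>"] by (simp add: eh)
  have e: "C (e_gen \<mu> \<alpha>) y = D (e_gen \<mu> \<alpha>) y" for \<alpha>
    by (rule WA_functional_eqI[OF linear_functional_of_form(2)[OF C e_gen_in_carrier]
          linear_functional_of_form(2)[OF D e_gen_in_carrier]]) (fact ee eh y)+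
  have h: "C (h_gen \<alpha>) y = D (h_gen \<alpha>) y" for \<alpha>
    by (rule WA_functional_eqI[OF linear_functional_of_form(2)[OF C h_gen_in_carrier]
          linear_functional_of_form(2)[OF D h_gen_in_carrier]]) (fact he hh y)+
  show ?thesis
    by (rule WA_functional_eqI[OF linear_functional_of_form(1)[OF C y]
          linear_functional_of_form(1)[OF D y]]) (fact e h x)+
qed

section \<open>The cocycle identity on generators\<close>

lemma bracket_h_e:
  "lie_bracket (WA \<mu>) (h_gen \<beta>) (e_gen \<mu> \<alpha>) = (- pairing \<mu> \<beta>) \<odot>\<^bsub>WA \<mu>\<^esub> h_gen (\<alpha> + \<beta>)"
  unfolding e_gen_def h_gen_eq[of _ \<mu>] WA_ops
  by (simp add: dmu_single mult_single single_uminus[symmetric])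

text \<open>Zero is written as a multiple of a generator so that every bracket of generators has the
  form scalar times generator, and homogeneity of a form applies to all of them.\<close>

lemma bracket_h_h_smult: "lie_bracket (WA \<mu>) (h_gen \<alpha>) (h_gen \<beta>) = 0 \<odot>\<^bsub>WA \<mu>\<^esub> h_gen (\<alpha> + \<beta>)"
  by (simp add: WA_def h_gen_def)

lemma cocycle_identity_linear:
  assumes "lie_algebra complex_field L" and C: "C \<in> skew_bilinear_forms L"
    and "y \<in> carrier L" and "z \<in> carrier L"
  shows "(\<lambda>x. C (lie_bracket L x y) z + C (lie_bracket L y z) x + C (lie_bracket L z x) y)
    \<in> linear_functionals L"
proof -
  interpret lie_algebra complex_field L by fact
  show ?thesis
    using assms(3,4) by (simp add: linear_functionals_def bracket_closed bracket_add_left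
        bracket_add_right bracket_smult_left bracket_smult_right skew_bilinear_formD(2-5)[OF C]
        algebra_simps)
qed

text \<open>Linearity reduces the identity to triples of generators, and its cyclic symmetry leaves
  the types (e, e, e), (e, e, h), (e, h, h) and (h, h, h). The last type holds trivially because the
  \<open>h_gen\<close> commute; the others give the three families.\<close>

lemma WA_two_cocycle_iff:
  assumes C: "C \<in> skew_bilinear_forms (WA \<mu>)"
  shows "C \<in> two_cocycles (WA \<mu>) \<longleftrightarrow>
    (\<forall>\<alpha> \<beta> \<gamma>. pairing \<mu> (\<beta> - \<alpha>) * C (e_gen \<mu> (\<alpha> + \<beta>)) (e_gen \<mu> \<gamma>)
      + pairing \<mu> (\<gamma> - \<beta>) * C (e_gen \<mu> (\<beta> + \<gamma>)) (e_gen \<mu> \<alpha>)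
      + pairing \<mu> (\<alpha> - \<gamma>) * C (e_gen \<mu> (\<gamma> + \<alpha>)) (e_gen \<mu> \<beta>) = 0) \<and>
    (\<forall>\<alpha> \<beta> \<gamma>. pairing \<mu> (\<beta> - \<alpha>) * C (e_gen \<mu> (\<alpha> + \<beta>)) (h_gen \<gamma>)
      + pairing \<mu> \<gamma> * C (h_gen (\<beta> + \<gamma>)) (e_gen \<mu> \<alpha>)
      - pairing \<mu> \<gamma> * C (h_gen (\<alpha> + \<gamma>)) (e_gen \<mu> \<beta>) = 0) \<and>
    (\<forall>\<alpha> \<beta> \<gamma>. pairing \<mu> \<beta> * C (h_gen (\<alpha> + \<beta>)) (h_gen \<gamma>)
      - pairing \<mu> \<gamma> * C (h_gen (\<alpha> + \<gamma>)) (h_gen \<beta>) = 0)"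
    (is "_ \<longleftrightarrow> ?eee \<and> ?eeh \<and> ?ehh")
proof -
  interpret lie_algebra complex_field "WA \<mu>" by (rule lie_algebra_WA)
  note [simp] = e_gen_in_carrier h_gen_in_carrier
  let ?J = "\<lambda>x y z. C (lie_bracket (WA \<mu>) x y) z + C (lie_bracket (WA \<mu>) y z) x
      + C (lie_bracket (WA \<mu>) z x) y"
  note brackets = bracket_e_e bracket_e_h bracket_h_e bracket_h_h_smult skew_bilinear_formD(4)[OF C]
  have eee: "?eee \<longleftrightarrow> (\<forall>\<alpha> \<beta> \<gamma>. ?J (e_gen \<mu> \<alpha>) (e_gen \<mu> \<beta>) (e_gen \<mu> \<gamma>) = 0)"
    by (simp add: brackets)
  have eeh: "?eeh \<longleftrightarrow> (\<forall>\<alpha> \<beta> \<gamma>. ?J (e_gen \<mu> \<alpha>) (e_gen \<mu> \<beta>) (h_gen \<gamma>) = 0)"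
    by (simp add: brackets)
  have ehh: "?ehh \<longleftrightarrow> (\<forall>\<alpha> \<beta> \<gamma>. ?J (e_gen \<mu> \<alpha>) (h_gen \<beta>) (h_gen \<gamma>) = 0)"
    by (simp add: brackets)
  have hhh: "?J (h_gen \<alpha>) (h_gen \<beta>) (h_gen \<gamma>) = 0" for \<alpha> \<beta> \<gamma>
    by (simp add: brackets)
  define B where "B = range (e_gen \<mu>) \<union> range h_gen"
  have extend: "?J x y z = 0"
    if "\<And>b. b \<in> B \<Longrightarrow> ?J b y z = 0" "x \<in> carrier (WA \<mu>)" "y \<in> carrier (WA \<mu>)" "z \<in> carrier (WA \<mu>)"
    for x y z
    by (rule WA_functional_eq_zero[OF cocycle_identity_linear[OF lie_algebra_WA C that(3,4)]])
      (use that in \<open>auto simp: B_def\<close>)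
  have BC: "b \<in> carrier (WA \<mu>)" if "b \<in> B" for b
    using that by (auto simp: B_def)
  show ?thesis
  proof
    assume "C \<in> two_cocycles (WA \<mu>)"
    from two_cocycle_jacobi[OF this] show "?eee \<and> ?eeh \<and> ?ehh"
      unfolding eee eeh ehh by simp
  next
    assume "?eee \<and> ?eeh \<and> ?ehh"
    then have eee': "?J (e_gen \<mu> \<alpha>) (e_gen \<mu> \<beta>) (e_gen \<mu> \<gamma>) = 0"
      and eeh': "?J (e_gen \<mu> \<alpha>) (e_gen \<mu> \<beta>) (h_gen \<gamma>) = 0"
      and ehh': "?J (e_gen \<mu> \<alpha>) (h_gen \<beta>) (h_gen \<gamma>) = 0" for \<alpha> \<beta> \<gamma>
      unfolding eee eeh ehh by iprover+
    have ehe: "?J (e_gen \<mu> \<alpha>) (h_gen \<beta>) (e_gen \<mu> \<gamma>) = 0"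
      and hee: "?J (h_gen \<beta>) (e_gen \<mu> \<gamma>) (e_gen \<mu> \<alpha>) = 0" for \<alpha> \<beta> \<gamma>
      using eeh'[of \<gamma> \<alpha> \<beta>] by (simp_all only: ac_simps)
    have heh: "?J (h_gen \<alpha>) (e_gen \<mu> \<beta>) (h_gen \<gamma>) = 0"
      and hhe: "?J (h_gen \<gamma>) (h_gen \<alpha>) (e_gen \<mu> \<beta>) = 0" for \<alpha> \<beta> \<gamma>
      using ehh'[of \<beta> \<gamma> \<alpha>] by (simp_all only: ac_simps)
    have BBB: "?J x y z = 0" if "x \<in> B" "y \<in> B" "z \<in> B" for x y z
      using that unfolding B_def
      by (elim UnE rangeE) (simp_all only: eee' eeh' ehe hee ehh' heh hhe hhh)
    \<comment> \<open>Only the first argument can be extended by \<open>extend\<close>. A cyclic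
      rotation brings the argument in question to the front, so the three arguments are freed one
      after another.\<close>
    have BB: "?J x y z = 0" if x: "x \<in> B" and y: "y \<in> B" and z: "z \<in> carrier (WA \<mu>)" for x y z
      using extend[of x y z, OF BBB[OF _ x y] z BC[OF x] BC[OF y]]
      by (simp only: ac_simps)
    have B1: "?J x y z = 0" if x: "x \<in> B" and y: "y \<in> carrier (WA \<mu>)" and z: "z \<in> carrier (WA \<mu>)"
      for x y z
    proof -
      have "?J b z x = 0" if "b \<in> B" for b
        using BB[OF x that z] by (simp only: ac_simps)
      from extend[of z x y, OF this y z BC[OF x]] show ?thesis
        by (simp only: ac_simps)
    qed
    show "C \<in> two_cocycles (WA \<mu>)"
    proof (rule two_cocyclesI[OF C])
      fix x y z
      assume xyz: "x \<in> carrier (WA \<mu>)" "y \<in> carrier (WA \<mu>)" "z \<in> carrier (WA \<mu>)"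
      show "?J x y z = 0" by (rule extend[OF B1[OF _ xyz(2,3)] xyz])
    qed
  qed
qed

section \<open>The functional equations of the weight-zero components\<close>

context
  fixes p :: "'g::ab_group_add \<Rightarrow> complex" and \<beta>0 :: 'g
  assumes p_add: "\<And>\<alpha> \<beta>. p (\<alpha> + \<beta>) = p \<alpha> + p \<beta>" and p_nonzero: "p \<beta>0 \<noteq> 0"
begin

text \<open>The equation at three pairs of degrees is a linear system for the values of
  \<open>\<theta>\<close> at \<open>\<alpha>\<close>, \<open>\<alpha> + \<beta>0\<close> and
  \<open>\<alpha> + \<beta>0 + \<beta>0\<close>. Its determinant \<open>12 * p \<beta>0 ^ 3\<close>
  is nonzero and independent of \<alpha>.\<close>

lemma virasoro_equation_zero:
  assumes eq: "\<And>\<alpha> \<beta>. (p \<beta> - p \<alpha>) * \<theta> (\<alpha> + \<beta>) + (p \<alpha> + 2 * p \<beta>) * \<theta> \<alpha> - (2 * p \<alpha> + p \<beta>) * \<theta> \<beta> = 0"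
    and "\<theta> \<beta>0 = 0" and "\<theta> (\<beta>0 + \<beta>0) = 0"
  shows "\<theta> \<alpha> = 0"
proof -
  have "(p \<beta>0 - p \<alpha>) * \<theta> (\<alpha> + \<beta>0) + (p \<alpha> + 2 * p \<beta>0) * \<theta> \<alpha> = 0"
    using eq[of \<beta>0 \<alpha>] assms(2) by simp
  moreover have "(- p \<alpha>) * \<theta> (\<alpha> + \<beta>0 + \<beta>0) + (p \<alpha> + 3 * p \<beta>0) * \<theta> (\<alpha> + \<beta>0) = 0"
    using eq[of \<beta>0 "\<alpha> + \<beta>0"] assms(2) by (simp add: p_add algebra_simps)
  moreover have "(2 * p \<beta>0 - p \<alpha>) * \<theta> (\<alpha> + \<beta>0 + \<beta>0) + (p \<alpha> + 4 * p \<beta>0) * \<theta> \<alpha> = 0"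
    using eq[of "\<beta>0 + \<beta>0" \<alpha>] assms(3) by (simp add: p_add algebra_simps)
  \<comment> \<open>the combination of the three relations that eliminates \<open>t1\<close> and \<open>t2\<close>\<close>
  moreover have "12 * b ^ 3 * t0 = (a + 3 * b) * (2 * b - a) * ((b - a) * t1 + (a + 2 * b) * t0)
      - (2 * b - a) * (b - a) * ((- a) * t2 + (a + 3 * b) * t1)
      - a * (b - a) * ((2 * b - a) * t2 + (a + 4 * b) * t0)" for a b t0 t1 t2 :: complex
    by (simp add: algebra_simps power2_eq_square power3_eq_cube)
  ultimately have "12 * p \<beta>0 ^ 3 * \<theta> \<alpha> = 0" by (metis diff_zero mult_zero_right)
  then show ?thesis using p_nonzero by simp
qed

lemma virasoro_equation_solution:
  assumes eq: "\<And>\<alpha> \<beta>. (p \<beta> - p \<alpha>) * \<theta> (\<alpha> + \<beta>) + (p \<alpha> + 2 * p \<beta>) * \<theta> \<alpha> - (2 * p \<alpha> + p \<beta>) * \<theta> \<beta> = 0"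
  obtains k l where "\<And>\<alpha>. \<theta> \<alpha> = k * p \<alpha> ^ 3 + l * p \<alpha>"
proof -
  let ?b = "p \<beta>0"
  \<comment> \<open>Interpolation: \<open>k\<close> and \<open>l\<close> are chosen so that the
    cubic agrees with \<open>\<theta>\<close> at \<open>\<beta>0\<close> and
    \<open>\<beta>0 + \<beta>0\<close>. The difference solves the same equation and is zero by
    uniqueness.\<close>
  define k where "k = (\<theta> (\<beta>0 + \<beta>0) - 2 * \<theta> \<beta>0) / (6 * ?b ^ 3)"
  define l where "l = (8 * \<theta> \<beta>0 - \<theta> (\<beta>0 + \<beta>0)) / (6 * ?b)"
  have k: "k * ?b ^ 3 = (\<theta> (\<beta>0 + \<beta>0) - 2 * \<theta> \<beta>0) / 6"
    and l: "l * ?b = (8 * \<theta> \<beta>0 - \<theta> (\<beta>0 + \<beta>0)) / 6"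
    using p_nonzero by (simp_all add: k_def l_def)
  have "\<theta> \<alpha> - (k * p \<alpha> ^ 3 + l * p \<alpha>) = 0" for \<alpha>
  proof (rule virasoro_equation_zero[of "\<lambda>\<alpha>. \<theta> \<alpha> - (k * p \<alpha> ^ 3 + l * p \<alpha>)"])
    show "\<theta> \<beta>0 - (k * ?b ^ 3 + l * ?b) = 0"
      unfolding k l by (simp add: field_simps)
    have "k * p (\<beta>0 + \<beta>0) ^ 3 + l * p (\<beta>0 + \<beta>0) = 8 * (k * ?b ^ 3) + 2 * (l * ?b)"
      by (simp add: p_add algebra_simps power2_eq_square power3_eq_cube)
    then show "\<theta> (\<beta>0 + \<beta>0) - (k * p (\<beta>0 + \<beta>0) ^ 3 + l * p (\<beta>0 + \<beta>0)) = 0"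
      unfolding k l by (simp add: field_simps)
    show "(p \<beta> - p \<alpha>) * (\<theta> (\<alpha> + \<beta>) - (k * p (\<alpha> + \<beta>) ^ 3 + l * p (\<alpha> + \<beta>)))
        + (p \<alpha> + 2 * p \<beta>) * (\<theta> \<alpha> - (k * p \<alpha> ^ 3 + l * p \<alpha>))
        - (2 * p \<alpha> + p \<beta>) * (\<theta> \<beta> - (k * p \<beta> ^ 3 + l * p \<beta>)) = 0" for \<alpha> \<beta>
      using eq[of \<beta> \<alpha>] by (simp add: p_add algebra_simps power2_eq_square power3_eq_cube)
  qed
  then show ?thesis by (intro that[of k l]) simp
qed

text \<open>The same elimination now has determinant
  \<open>2 * p \<beta>0 ^ 2 * (p \<alpha> + 2 * p \<beta>0)\<close>, so degrees with
  \<open>p \<alpha> = - 2 * p \<beta>0\<close> need a separate argument.\<close>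

lemma mixed_equation_zero:
  assumes eq: "\<And>\<alpha> \<beta>. (p \<beta> - p \<alpha>) * \<phi> (\<alpha> + \<beta>) + (p \<alpha> + p \<beta>) * (\<phi> \<alpha> - \<phi> \<beta>) = 0"
    and "\<phi> \<beta>0 = 0" and "\<phi> (\<beta>0 + \<beta>0) = 0"
  shows "\<phi> \<alpha> = 0"
proof -
  have *: "\<phi> \<alpha> = 0" if "p \<alpha> + 2 * p \<beta>0 \<noteq> 0" for \<alpha>
  proof -
    have "(p \<beta>0 - p \<alpha>) * \<phi> (\<alpha> + \<beta>0) + (p \<alpha> + p \<beta>0) * \<phi> \<alpha> = 0"
      using eq[of \<beta>0 \<alpha>] assms(2) by simp
    moreover have "(- p \<alpha>) * \<phi> (\<alpha> + \<beta>0 + \<beta>0) + (p \<alpha> + 2 * p \<beta>0) * \<phi> (\<alpha> + \<beta>0) = 0"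
      using eq[of \<beta>0 "\<alpha> + \<beta>0"] assms(2) by (simp add: p_add algebra_simps)
    moreover have "(2 * p \<beta>0 - p \<alpha>) * \<phi> (\<alpha> + \<beta>0 + \<beta>0) + (p \<alpha> + 2 * p \<beta>0) * \<phi> \<alpha> = 0"
      using eq[of "\<beta>0 + \<beta>0" \<alpha>] assms(3) by (simp add: p_add algebra_simps)
    moreover have "2 * b ^ 2 * (a + 2 * b) * t0
        = (a + 2 * b) * (2 * b - a) * ((b - a) * t1 + (a + b) * t0)
        - (2 * b - a) * (b - a) * ((- a) * t2 + (a + 2 * b) * t1)
        - a * (b - a) * ((2 * b - a) * t2 + (a + 2 * b) * t0)" for a b t0 t1 t2 :: complex
      by (simp add: algebra_simps power2_eq_square power3_eq_cube)
    ultimately have "2 * p \<beta>0 ^ 2 * (p \<alpha> + 2 * p \<beta>0) * \<phi> \<alpha> = 0"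
      by (metis diff_zero mult_zero_right)
    then show ?thesis using p_nonzero that by simp
  qed
  show ?thesis
  proof (cases "p \<alpha> + 2 * p \<beta>0 = 0")
    case True
    then have a: "p \<alpha> = - 2 * p \<beta>0" by (simp add: eq_neg_iff_add_eq_0)
    \<comment> \<open>Now \<open>p (\<alpha> + \<beta>0) = - p \<beta>0\<close>, so this shifted
      degree is regular. The equation for \<alpha> and \<open>\<beta>0\<close> then carries the
      vanishing back to \<alpha>.\<close>
    then have "\<phi> (\<alpha> + \<beta>0) = 0" using p_nonzero by (intro *) (simp add: p_add)
    then show ?thesis using eq[of \<beta>0 \<alpha>] a assms(2) p_nonzero by simp
  qed (rule *)
qed

lemma mixed_equation_solution:
  assumes eq: "\<And>\<alpha> \<beta>. (p \<beta> - p \<alpha>) * \<phi> (\<alpha> + \<beta>) + (p \<alpha> + p \<beta>) * (\<phi> \<alpha> - \<phi> \<beta>) = 0"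
  obtains k l where "\<And>\<alpha>. \<phi> \<alpha> = k * p \<alpha> ^ 2 + l * p \<alpha>"
proof -
  let ?b = "p \<beta>0"
  \<comment> \<open>Interpolation at \<open>\<beta>0\<close> and \<open>\<beta>0 + \<beta>0\<close>
    again, this time by a quadratic without constant term.\<close>
  define k where "k = (\<phi> (\<beta>0 + \<beta>0) - 2 * \<phi> \<beta>0) / (2 * ?b ^ 2)"
  define l where "l = (4 * \<phi> \<beta>0 - \<phi> (\<beta>0 + \<beta>0)) / (2 * ?b)"
  have k: "k * ?b ^ 2 = (\<phi> (\<beta>0 + \<beta>0) - 2 * \<phi> \<beta>0) / 2"
    and l: "l * ?b = (4 * \<phi> \<beta>0 - \<phi> (\<beta>0 + \<beta>0)) / 2"
    using p_nonzero by (simp_all add: k_def l_def)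
  have "\<phi> \<alpha> - (k * p \<alpha> ^ 2 + l * p \<alpha>) = 0" for \<alpha>
  proof (rule mixed_equation_zero[of "\<lambda>\<alpha>. \<phi> \<alpha> - (k * p \<alpha> ^ 2 + l * p \<alpha>)"])
    show "\<phi> \<beta>0 - (k * ?b ^ 2 + l * ?b) = 0"
      unfolding k l by (simp add: field_simps)
    have "k * p (\<beta>0 + \<beta>0) ^ 2 + l * p (\<beta>0 + \<beta>0) = 4 * (k * ?b ^ 2) + 2 * (l * ?b)"
      by (simp add: p_add algebra_simps power2_eq_square power3_eq_cube)
    then show "\<phi> (\<beta>0 + \<beta>0) - (k * p (\<beta>0 + \<beta>0) ^ 2 + l * p (\<beta>0 + \<beta>0)) = 0"
      unfolding k l by (simp add: field_simps)
    show "(p \<beta> - p \<alpha>) * (\<phi> (\<alpha> + \<beta>) - (k * p (\<alpha> + \<beta>) ^ 2 + l * p (\<alpha> + \<beta>)))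
        + (p \<alpha> + p \<beta>) * (\<phi> \<alpha> - (k * p \<alpha> ^ 2 + l * p \<alpha>) - (\<phi> \<beta> - (k * p \<beta> ^ 2 + l * p \<beta>))) = 0"
      for \<alpha> \<beta>
      using eq[of \<beta> \<alpha>] by (simp add: p_add algebra_simps power2_eq_square power3_eq_cube)
  qed
  then show ?thesis by (intro that[of k l]) simp
qed

end

section \<open>The three cocycles\<close>

lemma pairing_minus: "pairing \<mu> (- \<alpha>) = - pairing \<mu> \<alpha>"
  using pairing_diff[of \<mu> 0 \<alpha>] by (simp add: pairing_zero)

text \<open>In a cocycle identity for three generators either the total degree is zero, or all delta
  conditions fail together. The inequations have the shapes in which these conditions occur.\<close>

lemma sum_eq_zero_cases:
  fixes \<alpha> \<beta> \<gamma> :: "'a::ab_group_add"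
  obtains "\<gamma> = - \<alpha> - \<beta>" | "\<alpha> + \<beta> \<noteq> - \<gamma>" "\<beta> + \<gamma> \<noteq> - \<alpha>" "\<gamma> + \<alpha> \<noteq> - \<beta>" "\<alpha> + \<gamma> \<noteq> - \<beta>"
proof (cases "\<alpha> + \<beta> + \<gamma> = 0")
  case True
  then have "\<gamma> = - \<alpha> - \<beta>" using minus_unique[of "\<alpha> + \<beta>" \<gamma>] by simp
  then show ?thesis by (rule that)
next
  case False
  then show ?thesis by (intro that(2)) (simp_all add: eq_neg_iff_add_eq_0 add_ac)
qed

text \<open>In total degree zero the identity is a polynomial identity in
  \<open>pairing \<mu> \<alpha>\<close> and \<open>pairing \<mu> \<beta>\<close>; in every other
  degree all terms are zero. The other two cocycles are treated in the same way.\<close>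

lemma cocycle1_two_cocycle:
  assumes "generic \<mu>"
  shows "cocycle1 \<mu> c \<in> two_cocycles (WA \<mu>)"
proof -
  have F: "cocycle1 \<mu> c \<in> skew_bilinear_forms (WA \<mu>)"
    unfolding cocycle1_def
    by (rule form_of_values_skew_bilinear[OF assms]) (auto simp: pairing_minus minus_equation_iff field_simps)
  have "pairing \<mu> (\<beta> - \<alpha>) * (if \<alpha> + \<beta> = - \<gamma> then ((pairing \<mu> (\<alpha> + \<beta>)) ^ 3 - pairing \<mu> (\<alpha> + \<beta>)) / 12 * c else 0)
      + pairing \<mu> (\<gamma> - \<beta>) * (if \<beta> + \<gamma> = - \<alpha> then ((pairing \<mu> (\<beta> + \<gamma>)) ^ 3 - pairing \<mu> (\<beta> + \<gamma>)) / 12 * c else 0)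
      + pairing \<mu> (\<alpha> - \<gamma>) * (if \<gamma> + \<alpha> = - \<beta> then ((pairing \<mu> (\<gamma> + \<alpha>)) ^ 3 - pairing \<mu> (\<gamma> + \<alpha>)) / 12 * c else 0) = 0"
    for \<alpha> \<beta> \<gamma>
  proof (cases rule: sum_eq_zero_cases[of \<gamma> \<alpha> \<beta>])
    case 1
    show ?thesis
      unfolding 1 pairing_add pairing_diff pairing_minus
      by (simp add: field_simps power3_eq_cube)
  qed simp
  then show ?thesis
    unfolding WA_two_cocycle_iff[OF F] by (simp add: cocycle1_def form_of_values_basis[OF assms])
qed

lemma cocycle2_two_cocycle:
  assumes "generic \<mu>"
  shows "cocycle2 \<mu> c \<in> two_cocycles (WA \<mu>)"
proof -
  have F: "cocycle2 \<mu> c \<in> skew_bilinear_forms (WA \<mu>)"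
    unfolding cocycle2_def by (rule form_of_values_skew_bilinear[OF assms]) auto
  have "pairing \<mu> (\<beta> - \<alpha>) * (if \<alpha> + \<beta> = - \<gamma> then ((pairing \<mu> (\<alpha> + \<beta>)) ^ 2 - pairing \<mu> (\<alpha> + \<beta>)) * c else 0)
      + pairing \<mu> \<gamma> * (- (if \<alpha> = - (\<beta> + \<gamma>) then ((pairing \<mu> \<alpha>) ^ 2 - pairing \<mu> \<alpha>) * c else 0))
      - pairing \<mu> \<gamma> * (- (if \<beta> = - (\<alpha> + \<gamma>) then ((pairing \<mu> \<beta>) ^ 2 - pairing \<mu> \<beta>) * c else 0)) = 0"
    for \<alpha> \<beta> \<gamma>
  proof (cases rule: sum_eq_zero_cases[of \<gamma> \<alpha> \<beta>])
    case 1
    show ?thesis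
      unfolding 1 pairing_add pairing_diff pairing_minus
      by (simp add: algebra_simps power2_eq_square)
  next
    case 2
    \<comment> \<open>In the terms with exchanged arguments the delta condition is solved for a
      single degree, so the inequations are turned around.\<close>
    then have "\<alpha> \<noteq> - (\<beta> + \<gamma>)" "\<beta> \<noteq> - (\<alpha> + \<gamma>)" by (metis minus_minus)+
    with 2 show ?thesis by simp
  qed
  then show ?thesis
    unfolding WA_two_cocycle_iff[OF F] unfolding cocycle2_def form_of_values_basis[OF assms] by simp
qed

lemma cocycle3_two_cocycle:
  assumes "generic \<mu>"
  shows "cocycle3 \<mu> c \<in> two_cocycles (WA \<mu>)"
proof -
  have F: "cocycle3 \<mu> c \<in> skew_bilinear_forms (WA \<mu>)"
    unfolding cocycle3_def
    by (rule form_of_values_skew_bilinear[OF assms]) (auto simp: pairing_minus minus_equation_iff)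
  have "pairing \<mu> \<beta> * (if \<alpha> + \<beta> = - \<gamma> then pairing \<mu> (\<alpha> + \<beta>) / 3 * c else 0)
      - pairing \<mu> \<gamma> * (if \<alpha> + \<gamma> = - \<beta> then pairing \<mu> (\<alpha> + \<gamma>) / 3 * c else 0) = 0" for \<alpha> \<beta> \<gamma>
  proof (cases rule: sum_eq_zero_cases[of \<gamma> \<alpha> \<beta>])
    case 1
    show ?thesis
      unfolding 1 pairing_add pairing_diff pairing_minus
      by (simp add: field_simps)
  qed simp
  then show ?thesis
    unfolding WA_two_cocycle_iff[OF F] by (simp add: cocycle3_def form_of_values_basis[OF assms])
qed

lemma cocycle_values:
  assumes "generic \<mu>"
  shows "cocycle1 \<mu> c (e_gen \<mu> \<alpha>) (e_gen \<mu> \<beta>)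
      = (if \<alpha> = - \<beta> then ((pairing \<mu> \<alpha>) ^ 3 - pairing \<mu> \<alpha>) / 12 * c else 0)"
    and "cocycle1 \<mu> c (e_gen \<mu> \<alpha>) (h_gen \<beta>) = 0"
    and "cocycle1 \<mu> c (h_gen \<alpha>) (h_gen \<beta>) = 0"
    and "cocycle2 \<mu> c (e_gen \<mu> \<alpha>) (e_gen \<mu> \<beta>) = 0"
    and "cocycle2 \<mu> c (e_gen \<mu> \<alpha>) (h_gen \<beta>)
      = (if \<alpha> = - \<beta> then ((pairing \<mu> \<alpha>) ^ 2 - pairing \<mu> \<alpha>) * c else 0)"
    and "cocycle2 \<mu> c (h_gen \<alpha>) (h_gen \<beta>) = 0"
    and "cocycle3 \<mu> c (e_gen \<mu> \<alpha>) (e_gen \<mu> \<beta>) = 0"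
    and "cocycle3 \<mu> c (e_gen \<mu> \<alpha>) (h_gen \<beta>) = 0"
    and "cocycle3 \<mu> c (h_gen \<alpha>) (h_gen \<beta>) = (if \<alpha> = - \<beta> then pairing \<mu> \<alpha> / 3 * c else 0)"
  by (simp_all add: cocycle1_def cocycle2_def cocycle3_def form_of_values_basis[OF assms])

section \<open>Independence and spanning of the three classes\<close>

lemma functional_bracket_basis:
  assumes f: "f \<in> linear_functionals (WA \<mu>)"
  shows "f (lie_bracket (WA \<mu>) (e_gen \<mu> \<alpha>) (e_gen \<mu> \<beta>)) = pairing \<mu> (\<beta> - \<alpha>) * f (e_gen \<mu> (\<alpha> + \<beta>))"
    and "f (lie_bracket (WA \<mu>) (e_gen \<mu> \<alpha>) (h_gen \<beta>)) = pairing \<mu> \<beta> * f (h_gen (\<alpha> + \<beta>))"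
    and "f (lie_bracket (WA \<mu>) (h_gen \<alpha>) (h_gen \<beta>)) = 0"
  by (simp_all add: bracket_e_e bracket_e_h bracket_h_h_smult linear_functional_smult[OF f]
      e_gen_in_carrier h_gen_in_carrier)

text \<open>The index type is inhabited, so an axis vector provides a nonzero degree.\<close>

lemma generic_nonzero:
  fixes \<mu> :: "complex ^ 'n::finite"
  assumes "generic \<mu>"
  obtains \<alpha> where "pairing \<mu> \<alpha> \<noteq> 0"
proof (rule that)
  have "axis undefined 1 \<noteq> (0 :: int ^ 'n)" by (simp add: axis_eq_0_iff)
  then show "pairing \<mu> (axis undefined 1) \<noteq> 0" using assms by (simp add: generic_def)
qed

text \<open>On opposite degrees a coboundary is linear in \<open>pairing \<mu> \<alpha>\<close>,
  whereas the first two cocycles have a cubic and a quadratic part. Comparing the degrees \<alpha>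
  and \<open>\<alpha> + \<alpha>\<close> isolates these parts.\<close>

lemma cocycles_independent:
  fixes \<mu> :: "complex ^ 'n::finite"
  assumes "generic \<mu>" and c: "c1 \<noteq> 0" "c2 \<noteq> 0" "c3 \<noteq> 0"
    and f: "f \<in> linear_functionals (WA \<mu>)"
    and eq: "\<forall>x\<in>carrier (WA \<mu>). \<forall>y\<in>carrier (WA \<mu>).
      a * cocycle1 \<mu> c1 x y + (b * cocycle2 \<mu> c2 x y + c * cocycle3 \<mu> c3 x y)
      = f (lie_bracket (WA \<mu>) x y)"
  shows "a = 0 \<and> b = 0 \<and> c = 0"
proof -
  note [simp] = e_gen_in_carrier h_gen_in_carrier
  note vals = cocycle_values[OF assms(1)] functional_bracket_basis[OF f] pairing_diff pairing_minus
  obtain \<alpha> where \<alpha>: "pairing \<mu> \<alpha> \<noteq> 0" using generic_nonzero[OF assms(1)] .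
  define t where "t = pairing \<mu> \<alpha>"
  have t: "t \<noteq> 0" "pairing \<mu> \<alpha> = t" "pairing \<mu> (\<alpha> + \<alpha>) = 2 * t"
    unfolding t_def pairing_add mult_2 by (simp_all only: \<alpha> not_False_eq_True)
  have t2: "2 * t \<noteq> 0" using t(1) by simp
  have "a * ((t ^ 3 - t) / 12 * c1) = - 2 * t * f (e_gen \<mu> 0)"
    using eq[rule_format, of "e_gen \<mu> \<alpha>" "e_gen \<mu> (- \<alpha>)"] by (simp only: vals t) (simp add: t)
  then have "t * (a * c1 * (t ^ 2 - 1)) = t * (- 24 * f (e_gen \<mu> 0))"
    by (simp add: field_simps power2_eq_square power3_eq_cube)
  then have 1: "a * c1 * (t ^ 2 - 1) = - 24 * f (e_gen \<mu> 0)"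
    by (simp only: mult_left_cancel[OF t(1)])
  \<comment> \<open>Doubling the degree involves the same unknown \<open>f (e_gen \<mu> 0)\<close>;
    subtracting the two relations removes it and leaves \<open>3 * t ^ 2\<close>.\<close>
  have "a * (((2 * t) ^ 3 - 2 * t) / 12 * c1) = - 4 * t * f (e_gen \<mu> 0)"
    using eq[rule_format, of "e_gen \<mu> (\<alpha> + \<alpha>)" "e_gen \<mu> (- (\<alpha> + \<alpha>))"] by (simp only: vals t) (simp add: t)
  then have "2 * t * (a * c1 * (4 * t ^ 2 - 1)) = 2 * t * (- 24 * f (e_gen \<mu> 0))"
    by (simp add: field_simps power2_eq_square power3_eq_cube)
  then have "a * c1 * (4 * t ^ 2 - 1) = - 24 * f (e_gen \<mu> 0)"
    by (simp only: mult_left_cancel[OF t2])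
  moreover have "a * c1 * (3 * t ^ 2) = a * c1 * (4 * t ^ 2 - 1) - a * c1 * (t ^ 2 - 1)"
    by (simp add: algebra_simps)
  ultimately have "a * c1 * (3 * t ^ 2) = 0" using 1 by simp
  then have "a = 0" using c t by simp
  have "b * ((t ^ 2 - t) * c2) = - t * f (h_gen 0)"
    using eq[rule_format, of "e_gen \<mu> \<alpha>" "h_gen (- \<alpha>)"] by (simp only: vals t) (simp add: t)
  then have "t * (b * c2 * (t - 1)) = t * (- f (h_gen 0))"
    by (simp add: field_simps power2_eq_square)
  then have 2: "b * c2 * (t - 1) = - f (h_gen 0)"
    by (simp only: mult_left_cancel[OF t(1)])
  have "b * (((2 * t) ^ 2 - 2 * t) * c2) = - 2 * t * f (h_gen 0)"
    using eq[rule_format, of "e_gen \<mu> (\<alpha> + \<alpha>)" "h_gen (- (\<alpha> + \<alpha>))"] by (simp only: vals t) (simp add: t)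
  then have "2 * t * (b * c2 * (2 * t - 1)) = 2 * t * (- f (h_gen 0))"
    by (simp add: field_simps power2_eq_square)
  then have "b * c2 * (2 * t - 1) = - f (h_gen 0)"
    by (simp only: mult_left_cancel[OF t2])
  moreover have "b * c2 * t = b * c2 * (2 * t - 1) - b * c2 * (t - 1)"
    by (simp add: algebra_simps)
  ultimately have "b * c2 * t = 0" using 2 by simp
  then have "b = 0" using c t by simp
  \<comment> \<open>Brackets of two \<open>h_gen\<close> vanish, so no coboundary can interfere
    here.\<close>
  have "c * (t / 3 * c3) = 0"
    using eq[rule_format, of "h_gen \<alpha>" "h_gen (- \<alpha>)"] by (simp only: vals t) (simp add: t)
  then have "c = 0" using c t by simp
  with \<open>a = 0\<close> \<open>b = 0\<close> show ?thesis by simp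
qed

text \<open>The three functional equations determine the coefficients from the values in opposite
  degrees, and the bracket with \<open>e_gen \<mu> 0\<close> determines the functional in the
  nonzero degrees.\<close>

lemma cocycle_decomposition:
  fixes \<mu> :: "complex ^ 'n::finite"
  assumes gen: "generic \<mu>" and c: "c1 \<noteq> 0" "c2 \<noteq> 0" "c3 \<noteq> 0"
    and C: "C \<in> two_cocycles (WA \<mu>)"
  shows "\<exists>a b c f. f \<in> linear_functionals (WA \<mu>) \<and>
    (\<forall>x\<in>carrier (WA \<mu>). \<forall>y\<in>carrier (WA \<mu>).
      C x y = a * cocycle1 \<mu> c1 x y + (b * cocycle2 \<mu> c2 x y + c * cocycle3 \<mu> c3 x y)
        + f (lie_bracket (WA \<mu>) x y))"
proof -
  note [simp] = e_gen_in_carrier h_gen_in_carrier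
  define p where "p = pairing \<mu>"
  have p: "p (\<alpha> + \<beta>) = p \<alpha> + p \<beta>" "p (\<alpha> - \<beta>) = p \<alpha> - p \<beta>" "p (- \<alpha>) = - p \<alpha>" "p 0 = 0" for \<alpha> \<beta>
    by (simp_all add: p_def pairing_add pairing_diff pairing_minus pairing_zero)
  have p_eq_0: "p \<alpha> = 0 \<longleftrightarrow> \<alpha> = 0" for \<alpha>
    using gen p(4) by (auto simp: p_def generic_def)
  obtain \<beta>0 where \<beta>0: "p \<beta>0 \<noteq> 0" using generic_nonzero[OF gen] by (auto simp: p_def)
  note bilin = two_cocycle_skew_bilinear[OF C]
  define E where "E \<alpha> \<beta> = C (e_gen \<mu> \<alpha>) (e_gen \<mu> \<beta>)" for \<alpha> \<beta>
  define F where "F \<alpha> \<beta> = C (e_gen \<mu> \<alpha>) (h_gen \<beta>)" for \<alpha> \<beta>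
  define H where "H \<alpha> \<beta> = C (h_gen \<alpha>) (h_gen \<beta>)" for \<alpha> \<beta>
  have skew: "E \<alpha> \<beta> = - E \<beta> \<alpha>" "H \<alpha> \<beta> = - H \<beta> \<alpha>" "C (h_gen \<beta>) (e_gen \<mu> \<alpha>) = - F \<alpha> \<beta>" for \<alpha> \<beta>
    unfolding E_def F_def H_def by (rule skew_bilinear_formD(6)[OF bilin]; simp)+
  have EEE: "(p \<beta> - p \<alpha>) * E (\<alpha> + \<beta>) \<gamma> + (p \<gamma> - p \<beta>) * E (\<beta> + \<gamma>) \<alpha>
      + (p \<alpha> - p \<gamma>) * E (\<gamma> + \<alpha>) \<beta> = 0"
    and EEH: "(p \<beta> - p \<alpha>) * F (\<alpha> + \<beta>) \<gamma> - p \<gamma> * F \<alpha> (\<beta> + \<gamma>) + p \<gamma> * F \<beta> (\<alpha> + \<gamma>) = 0"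
    and EHH: "p \<beta> * H (\<alpha> + \<beta>) \<gamma> - p \<gamma> * H (\<alpha> + \<gamma>) \<beta> = 0" for \<alpha> \<beta> \<gamma>
    using C unfolding WA_two_cocycle_iff[OF bilin] skew(3) E_def[symmetric] F_def[symmetric]
      H_def[symmetric] p_def[symmetric] p by simp_all

  \<comment> \<open>The identity on three \<open>e_gen\<close> with total degree zero, rewritten by
    skewness as an equation for \<open>E \<alpha> (- \<alpha>)\<close> alone.\<close>
  have "(p \<beta> - p \<alpha>) * E (\<alpha> + \<beta>) (- (\<alpha> + \<beta>)) + (p \<alpha> + 2 * p \<beta>) * E \<alpha> (- \<alpha>)
      - (2 * p \<alpha> + p \<beta>) * E \<beta> (- \<beta>) = 0" for \<alpha> \<beta>
    using EEE[of \<beta> \<alpha> "- (\<alpha> + \<beta>)"] skew(1)[of "- \<alpha>" \<alpha>] skew(1)[of "- \<beta>" \<beta>]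
    by (simp add: p algebra_simps)
  from virasoro_equation_solution[of p \<beta>0 "\<lambda>\<alpha>. E \<alpha> (- \<alpha>)", OF p(1) \<beta>0 this]
  obtain k1 l1 where E0: "\<And>\<alpha>. E \<alpha> (- \<alpha>) = k1 * p \<alpha> ^ 3 + l1 * p \<alpha>" by blast
  have "(p \<beta> - p \<alpha>) * F (\<alpha> + \<beta>) (- (\<alpha> + \<beta>)) + (p \<alpha> + p \<beta>) * (F \<alpha> (- \<alpha>) - F \<beta> (- \<beta>)) = 0"
    for \<alpha> \<beta>
    using EEH[of \<beta> \<alpha> "- (\<alpha> + \<beta>)"] by (simp add: p algebra_simps)
  from mixed_equation_solution[of p \<beta>0 "\<lambda>\<alpha>. F \<alpha> (- \<alpha>)", OF p(1) \<beta>0 this]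
  obtain k2 l2 where F0: "\<And>\<alpha>. F \<alpha> (- \<alpha>) = k2 * p \<alpha> ^ 2 + l2 * p \<alpha>" by blast
  define k3 where "k3 = H \<beta>0 (- \<beta>0) / p \<beta>0"
  \<comment> \<open>The degrees \<open>\<alpha> - \<beta>0\<close>, \<open>\<beta>0\<close> and
    \<open>- \<alpha>\<close> add up to zero and link the value at \<alpha> to the one at
    \<open>\<beta>0\<close>.\<close>
  have H0: "H \<alpha> (- \<alpha>) = k3 * p \<alpha>" for \<alpha>
    using EHH[of \<beta>0 "\<alpha> - \<beta>0" "- \<alpha>"] skew(2)[of "- \<beta>0" \<beta>0] \<beta>0
    by (simp add: p k3_def field_simps)

  \<comment> \<open>The multiples of \<open>p \<alpha> ^ 3 - p \<alpha>\<close> and \<open>p \<alpha> ^ 2 - p \<alpha>\<close> leave the linear parts \<open>(k1 + l1) * p \<alpha>\<close> and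
    \<open>(k2 + l2) * p \<alpha>\<close>, which fixes the values of \<open>f\<close> in degree \<open>0\<close>.\<close>
  define f where "f = functional_of_values \<mu>
    (\<lambda>\<gamma>. if \<gamma> = 0 then - (k1 + l1) / 2 else E 0 \<gamma> / p \<gamma>)
    (\<lambda>\<gamma>. if \<gamma> = 0 then - (k2 + l2) else F 0 \<gamma> / p \<gamma>)"
  have f: "f \<in> linear_functionals (WA \<mu>)"
    unfolding f_def by (rule functional_of_values_linear[OF gen])
  \<comment> \<open>The factors 12 and 3 and the divisions by \<open>c1\<close>, \<open>c2\<close>,
    \<open>c3\<close> undo the normalizations of the cocycles, leaving \<open>k1\<close>,
    \<open>k2\<close> and \<open>k3\<close>.\<close>
  let ?S = "\<lambda>x y. 12 * k1 / c1 * cocycle1 \<mu> c1 x y + (k2 / c2 * cocycle2 \<mu> c2 x y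
      + 3 * k3 / c3 * cocycle3 \<mu> c3 x y)"
  let ?f = "\<lambda>x y. if x \<in> carrier (WA \<mu>) \<and> y \<in> carrier (WA \<mu>) then f (lie_bracket (WA \<mu>) x y) else 0"
  have D: "(\<lambda>x y. ?S x y + ?f x y) \<in> skew_bilinear_forms (WA \<mu>)"
  proof (intro two_cocycle_skew_bilinear two_cocycles_add two_cocycles_smult
      cocycle1_two_cocycle cocycle2_two_cocycle cocycle3_two_cocycle gen)
    show "?f \<in> two_cocycles (WA \<mu>)"
      using submodule.subset[OF submodule_two_coboundaries[OF lie_algebra_WA]] two_coboundaryI[OF f]
      by (simp only: cocycle_space_simps) blast
  qed
  have "C x y = ?S x y + ?f x y" if "x \<in> carrier (WA \<mu>)" "y \<in> carrier (WA \<mu>)" for x y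
  proof (rule WA_form_eqI[OF bilin D _ _ _ that])
    fix \<alpha> \<beta> :: "int ^ 'n"
    have sum0: "\<alpha> = - \<beta>" if "p \<alpha> + p \<beta> = 0"
      using that p_eq_0[of "\<alpha> + \<beta>"] by (simp add: p eq_neg_iff_add_eq_0)
    note vals = cocycle_values[OF gen] functional_bracket_basis[OF f] p_def[symmetric] p
    have fe: "f (e_gen \<mu> \<gamma>) = (if \<gamma> = 0 then - (k1 + l1) / 2 else E 0 \<gamma> / p \<gamma>)"
      and fh: "f (h_gen \<gamma>) = (if \<gamma> = 0 then - (k2 + l2) else F 0 \<gamma> / p \<gamma>)" for \<gamma>
      by (simp_all only: f_def functional_of_values_basis[OF gen])
    show "C (e_gen \<mu> \<alpha>) (e_gen \<mu> \<beta>) = ?S (e_gen \<mu> \<alpha>) (e_gen \<mu> \<beta>) + ?f (e_gen \<mu> \<alpha>) (e_gen \<mu> \<beta>)"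
    proof (cases "\<alpha> = - \<beta>")
      case True
      then have "\<beta> = - \<alpha>" by simp
      then show ?thesis
        using E0[of \<alpha>] c
        by (simp only: E_def[symmetric] vals fe e_gen_in_carrier h_gen_in_carrier simp_thms if_True
            minus_minus right_minus) (simp add: field_simps)
    next
      case False
      then have nz: "p \<alpha> + p \<beta> \<noteq> 0" "\<alpha> + \<beta> \<noteq> 0" using sum0 by (auto simp: eq_neg_iff_add_eq_0)
      \<comment> \<open>The identity for \<open>e_gen \<mu> 0\<close>,
        \<open>e_gen \<mu> \<alpha>\<close> and \<open>e_gen \<mu> \<beta>\<close>: the first acts
        with total eigenvalue \<open>p \<alpha> + p \<beta>\<close>. Dividing by it gives the value
        of the coboundary, since \<open>f\<close> on \<open>e_gen \<mu> \<gamma>\<close> is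
        \<open>E 0 \<gamma> / p \<gamma>\<close> for nonzero \<gamma>.\<close>
      have "(p \<alpha> + p \<beta>) * E \<alpha> \<beta> = (p \<beta> - p \<alpha>) * E 0 (\<alpha> + \<beta>)"
        using EEE[of \<alpha> 0 \<beta>] skew(1)[of "\<alpha> + \<beta>" 0] skew(1)[of \<beta> \<alpha>] by (simp add: p algebra_simps)
      then show ?thesis
        using nz False by (simp add: E_def[symmetric] vals fe field_simps)
    qed
    show "C (e_gen \<mu> \<alpha>) (h_gen \<beta>) = ?S (e_gen \<mu> \<alpha>) (h_gen \<beta>) + ?f (e_gen \<mu> \<alpha>) (h_gen \<beta>)"
    proof (cases "\<alpha> = - \<beta>")
      case True
      then have "\<beta> = - \<alpha>" by simp
      then show ?thesis
        using F0[of \<alpha>] c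
        by (simp only: F_def[symmetric] vals fh e_gen_in_carrier h_gen_in_carrier simp_thms if_True
            minus_minus right_minus) (simp add: field_simps)
    next
      case False
      then have nz: "p \<alpha> + p \<beta> \<noteq> 0" "\<alpha> + \<beta> \<noteq> 0" using sum0 by (auto simp: eq_neg_iff_add_eq_0)
      have "(p \<alpha> + p \<beta>) * F \<alpha> \<beta> = p \<beta> * F 0 (\<alpha> + \<beta>)"
        using EEH[of \<alpha> 0 \<beta>] by (simp add: p algebra_simps)
      then show ?thesis
        using nz False by (simp add: F_def[symmetric] vals fh field_simps)
    qed
    show "C (h_gen \<alpha>) (h_gen \<beta>) = ?S (h_gen \<alpha>) (h_gen \<beta>) + ?f (h_gen \<alpha>) (h_gen \<beta>)"
    proof (cases "\<alpha> = - \<beta>")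
      case True
      then show ?thesis
        using H0[of \<alpha>] c by (simp add: H_def[symmetric] vals)
    next
      case False
      then have "p \<alpha> + p \<beta> \<noteq> 0" using sum0 by auto
      \<comment> \<open>The bracket of the two \<open>h_gen\<close> is zero, so the same argument
        leaves no right-hand side and \<open>H\<close> vanishes off opposite degrees.\<close>
      moreover have "(p \<alpha> + p \<beta>) * H \<alpha> \<beta> = 0"
        using EHH[of \<alpha> 0 \<beta>] skew(2)[of \<beta> \<alpha>] by (simp add: p algebra_simps)
      ultimately show ?thesis
        using False by (simp add: H_def[symmetric] vals)
    qed
  qed
  then show ?thesis using f
    by (intro exI[of _ "12 * k1 / c1"] exI[of _ "k2 / c2"] exI[of _ "3 * k3 / c3"] exI[of _ f]) auto
qed

theorem theorem2p1:
  fixes \<mu> :: "complex ^ 'n::finite" and c1 c2 c3 :: complex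
  assumes "generic \<mu>" and "c1 \<noteq> 0" and "c2 \<noteq> 0" and "c3 \<noteq> 0"
  shows "vectorspace complex_field (second_cohomology (WA \<mu>)) \<and>
    vectorspace.fin_dim complex_field (second_cohomology (WA \<mu>)) \<and>
    vectorspace.dim complex_field (second_cohomology (WA \<mu>)) = 3 \<and>
    cocycle1 \<mu> c1 \<in> two_cocycles (WA \<mu>) \<and>
    cocycle2 \<mu> c2 \<in> two_cocycles (WA \<mu>) \<and>
    cocycle3 \<mu> c3 \<in> two_cocycles (WA \<mu>) \<and>
    module.span complex_field (second_cohomology (WA \<mu>))
      {cohomology_class (WA \<mu>) (cocycle1 \<mu> c1),
       cohomology_class (WA \<mu>) (cocycle2 \<mu> c2),
       cohomology_class (WA \<mu>) (cocycle3 \<mu> c3)}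
    = carrier (second_cohomology (WA \<mu>))"
proof -
  note cocycles = cocycle1_two_cocycle[OF assms(1), of c1] cocycle2_two_cocycle[OF assms(1), of c2]
    cocycle3_two_cocycle[OF assms(1), of c3]
  note basis = second_cohomology_basis[OF lie_algebra_WA cocycles]
  show ?thesis
    by (intro conjI cocycles; rule basis;
        (erule cocycle_decomposition[OF assms] | erule (1) cocycles_independent[OF assms]))
qed

end
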